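(* Let $\ell>0$ and let $(y,r)$ be a regular solution (in the sense of the context) of the equilibrium boundary value problem given in the context with $\bar y=0$ and $\bar r=(e_1|-e_2|-e_3)$. Then the curve $y$ is not planar, i.e. $d_1$ does not lie on a plane (there is no unit vector $k\in\mathbb{R}^3$ with $d_1(s)\cdot k=0$ for every $s\in(0,\ell)$).
   Context: $(e_1,e_2,e_3)$ is the canonical basis of $\mathbb{R}^3$ and $\wedge$ is the cross product. Let $$\overline Q(\mu,\tau)=\begin{cases}\dfrac{(\mu^2+\tau^2)^2}{\mu^2}&\text{if }|\mu|>|\tau|,\\ 4\tau^2&\text{if }|\mu|\le|\tau|,\end{cases}$$ whose partial derivatives are $$\frac{\partial\overline Q}{\partial\tau}(\mu,\tau)=\begin{cases}4\tau\dfrac{\mu^2+\tau^2}{\mu^2}&|\mu|>|\tau|,\\ 8\tau&|\mu|\le|\tau|,\end{cases}\qquad\frac{\partial\overline Q}{\partial\mu}(\mu,\tau)=\begin{cases}2\dfrac{\mu^4-\tau^4}{\mu^3}&|\mu|>|\tau|,\\ 0&|\mu|\le|\tau|.\end{cases}$$ Given $\bar y\in\mathbb{R}^3$ and $\bar r\in SO(3)$, a solution of the equilibrium boundary value problem is a pair $(y,r)\in W^{2,2}((0,\ell);\mathbb{R}^3)\times W^{1,2}((0,\ell);SO(3))$, $r^T=(d_1|d_2|d_3)$, with $y'=d_1$, for which there exist $\lambda_1,\lambda_2\in\mathbb{R}^3$ such that $$\begin{cases}\dfrac{\partial\overline Q}{\partial\tau}(d_1'\cdot d_3,-d_2'\cdot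 d_3)=(\lambda_2+\lambda_1\wedge y)\cdot d_1&\text{a.e. in }(0,\ell),\\[2mm]\dfrac{\partial\overline Q}{\partial\mu}(d_1'\cdot d_3,-d_2'\cdot d_3)=(\lambda_2+\lambda_1\wedge y)\cdot d_2&\text{a.e. in }(0,\ell),\\[2mm] d_1'\cdot d_2=0&\text{a.e. in }(0,\ell),\\ y(0)=0,\quad y(\ell)=\bar y,\\ r(0)=\mathrm{Id},\quad r(\ell)=\bar r.\end{cases}$$ Such a solution is called regular if there exists a family $\mathscr{F}$ of pairwise disjoint open subintervals of $(0,\ell)$ such that $|(0,\ell)\setminus\bigcup\mathscr{F}|=0$ (Lebesgue measure) and such that in every $J\in\mathscr{F}$ the curvature $\mu=d_1'\cdot d_3$ is a.e. strictly positive, or a.e. strictly negative, or a.e. zero. *)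

theory Defs
  imports "HOL-Analysis.Analysis"
begin

section \<open>Sobolev functions on an open set of reals\<close>

definition locally_integrable_on :: "real set \<Rightarrow> (real \<Rightarrow> 'a::euclidean_space) \<Rightarrow> bool" where
  "locally_integrable_on I f \<longleftrightarrow>
     (\<forall>K. compact K \<and> K \<subseteq> I \<longrightarrow> integrable (lebesgue_on K) f)"

definition C1_test_function :: "real set \<Rightarrow> (real \<Rightarrow> real) \<Rightarrow> bool" where
  "C1_test_function I \<phi> \<longleftrightarrow>
     \<phi> C1_differentiable_on UNIV \<and>
     (\<exists>K. compact K \<and> K \<subseteq> I \<and> (\<forall>x. x \<notin> K \<longrightarrow> \<phi> x = 0))"

text \<open>Compactly supported \<open>C\<^sup>1\<close> test functions, as in Brezis' textbook treatment of Sobolev spaces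
  on intervals; by mollification they give the same notion as smooth ones. Local integrability
  of both functions is part of the definition, because a Bochner integral that does not exist
  is 0 by convention.\<close>

definition has_weak_derivative_on ::
    "(real \<Rightarrow> 'a::euclidean_space) \<Rightarrow> (real \<Rightarrow> 'a) \<Rightarrow> real set \<Rightarrow> bool" where
  "has_weak_derivative_on f g I \<longleftrightarrow>
     locally_integrable_on I f \<and> locally_integrable_on I g \<and>
     (\<forall>\<phi>. C1_test_function I \<phi> \<longrightarrow>
        (LINT x|lebesgue_on I. deriv \<phi> x *\<^sub>R f x) = - (LINT x|lebesgue_on I. \<phi> x *\<^sub>R g x))"

text \<open>A representative of the weak derivative, which is unique up to null sets; only
  properties insensitive to null sets are asked of it below.\<close>

definition weak_derivative ::
    "real set \<Rightarrow> (real \<Rightarrow> 'a::euclidean_space) \<Rightarrow> real \<Rightarrow> 'a" where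
  "weak_derivative I f = (SOME g. has_weak_derivative_on f g I)"

definition L2_on :: "real set \<Rightarrow> (real \<Rightarrow> 'a::euclidean_space) \<Rightarrow> bool" where
  "L2_on I f \<longleftrightarrow> f \<in> borel_measurable (lebesgue_on I) \<and>
     integrable (lebesgue_on I) (\<lambda>x. (norm (f x))\<^sup>2)"

definition W12_on :: "real set \<Rightarrow> (real \<Rightarrow> 'a::euclidean_space) \<Rightarrow> bool" where
  "W12_on I f \<longleftrightarrow> L2_on I f \<and> (\<exists>g. L2_on I g \<and> has_weak_derivative_on f g I)"

definition W22_on :: "real set \<Rightarrow> (real \<Rightarrow> 'a::euclidean_space) \<Rightarrow> bool" where
  "W22_on I f \<longleftrightarrow> W12_on I f \<and> W12_on I (weak_derivative I f)"

section \<open>The energy density\<close>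

definition Qbar :: "real \<Rightarrow> real \<Rightarrow> real" where
  "Qbar \<mu> \<tau> = (if \<bar>\<mu>\<bar> > \<bar>\<tau>\<bar> then (\<mu>\<^sup>2 + \<tau>\<^sup>2)\<^sup>2 / \<mu>\<^sup>2 else 4 * \<tau>\<^sup>2)"

definition dQbar_d\<tau> :: "real \<Rightarrow> real \<Rightarrow> real" where
  "dQbar_d\<tau> \<mu> \<tau> = deriv (\<lambda>t. Qbar \<mu> t) \<tau>"

definition dQbar_d\<mu> :: "real \<Rightarrow> real \<Rightarrow> real" where
  "dQbar_d\<mu> \<mu> \<tau> = deriv (\<lambda>m. Qbar m \<tau>) \<mu>"

lemma has_real_derivative_If_closed:
  fixes f g :: "real \<Rightarrow> real"
  assumes "closed S" "closed T" "S \<union> T = UNIV"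
    and "x \<in> S \<Longrightarrow> (f has_real_derivative f') (at x)"
    and "x \<in> T \<Longrightarrow> (g has_real_derivative g') (at x)"
    and "x \<in> S \<Longrightarrow> x \<in> T \<Longrightarrow> f x = g x \<and> f' = g'"
  shows "((\<lambda>x. if x \<in> S then f x else g x) has_real_derivative (if x \<in> S then f' else g')) (at x)"
  unfolding has_real_derivative_iff_has_vector_derivative
  by (rule has_vector_derivative_If_within_closures[where T = T])
    (use assms in \<open>auto simp: has_real_derivative_iff_has_vector_derivative
       intro: has_vector_derivative_at_within\<close>)

text \<open>The partial derivatives exist everywhere and are given by the expected formulas.\<close>

lemma Qbar_partial_\<tau>:
  "((\<lambda>t. Qbar \<mu> t) has_real_derivative
     (if \<bar>\<mu>\<bar> > \<bar>\<tau>\<bar> then 4 * \<tau> * ((\<mu>\<^sup>2 + \<tau>\<^sup>2) / \<mu>\<^sup>2) else 8 * \<tau>)) (at \<tau>)"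
proof (cases "\<mu> = 0")
  case True
  then show ?thesis
    by (auto simp: Qbar_def intro!: derivative_eq_intros)
next
  case False
  let ?S = "{t. \<bar>\<mu>\<bar> \<le> \<bar>t\<bar>}" and ?T = "{t. \<bar>t\<bar> \<le> \<bar>\<mu>\<bar>}"
  have eq: "(\<lambda>t. Qbar \<mu> t) = (\<lambda>t. if t \<in> ?S then 4 * t\<^sup>2 else (\<mu>\<^sup>2 + t\<^sup>2)\<^sup>2 / \<mu>\<^sup>2)"
    by (auto simp: Qbar_def fun_eq_iff)
  have sq: "t\<^sup>2 = \<mu>\<^sup>2" if "t \<in> ?S" "t \<in> ?T" for t
    using that by (auto intro: antisym simp: abs_le_square_iff)
  have "((\<lambda>t. if t \<in> ?S then 4 * t\<^sup>2 else (\<mu>\<^sup>2 + t\<^sup>2)\<^sup>2 / \<mu>\<^sup>2) has_real_derivative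
      (if \<tau> \<in> ?S then 8 * \<tau> else 4 * \<tau> * ((\<mu>\<^sup>2 + \<tau>\<^sup>2) / \<mu>\<^sup>2))) (at \<tau>)"
  proof (rule has_real_derivative_If_closed[where T = ?T])
    show "closed ?S" "closed ?T"
      by (intro closed_Collect_le continuous_intros)+
    show "?S \<union> ?T = UNIV" by auto
    show "((\<lambda>t. 4 * t\<^sup>2) has_real_derivative 8 * \<tau>) (at \<tau>)"
      by (auto intro!: derivative_eq_intros)
    show "((\<lambda>t. (\<mu>\<^sup>2 + t\<^sup>2)\<^sup>2 / \<mu>\<^sup>2) has_real_derivative 4 * \<tau> * ((\<mu>\<^sup>2 + \<tau>\<^sup>2) / \<mu>\<^sup>2)) (at \<tau>)"
      using False by (auto intro!: derivative_eq_intros simp: field_simps)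
    show "4 * \<tau>\<^sup>2 = (\<mu>\<^sup>2 + \<tau>\<^sup>2)\<^sup>2 / \<mu>\<^sup>2 \<and> 8 * \<tau> = 4 * \<tau> * ((\<mu>\<^sup>2 + \<tau>\<^sup>2) / \<mu>\<^sup>2)"
      if "\<tau> \<in> ?S" "\<tau> \<in> ?T"
      using False sq[OF that] by (simp add: power2_eq_square)
  qed
  then show ?thesis
    unfolding eq by (auto simp: not_less split: if_splits)
qed

lemma Qbar_partial_\<mu>:
  "((\<lambda>m. Qbar m \<tau>) has_real_derivative
     (if \<bar>\<mu>\<bar> > \<bar>\<tau>\<bar> then 2 * ((\<mu> ^ 4 - \<tau> ^ 4) / \<mu> ^ 3) else 0)) (at \<mu>)"
proof (cases "\<tau> = 0")
  case True
  have eq: "(\<lambda>m. Qbar m \<tau>) = (\<lambda>m. m\<^sup>2)"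
    using True by (auto simp: Qbar_def fun_eq_iff power2_eq_square)
  have d: "(if \<bar>\<mu>\<bar> > \<bar>\<tau>\<bar> then 2 * ((\<mu> ^ 4 - \<tau> ^ 4) / \<mu> ^ 3) else 0) = 2 * \<mu>"
    using True by (auto simp: field_simps eval_nat_numeral)
  show ?thesis
    unfolding eq d by (auto intro!: derivative_eq_intros)
next
  case False
  let ?S = "{m. \<bar>m\<bar> \<le> \<bar>\<tau>\<bar>}" and ?T = "{m. \<bar>\<tau>\<bar> \<le> \<bar>m\<bar>}"
  have eq: "(\<lambda>m. Qbar m \<tau>) = (\<lambda>m. if m \<in> ?S then 4 * \<tau>\<^sup>2 else (m\<^sup>2 + \<tau>\<^sup>2)\<^sup>2 / m\<^sup>2)"
    by (auto simp: Qbar_def fun_eq_iff)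
  have sq: "m\<^sup>2 = \<tau>\<^sup>2" if "m \<in> ?S" "m \<in> ?T" for m
    using that by (auto intro: antisym simp: abs_le_square_iff)
  have "((\<lambda>m. if m \<in> ?S then 4 * \<tau>\<^sup>2 else (m\<^sup>2 + \<tau>\<^sup>2)\<^sup>2 / m\<^sup>2) has_real_derivative
      (if \<mu> \<in> ?S then 0 else 2 * ((\<mu> ^ 4 - \<tau> ^ 4) / \<mu> ^ 3))) (at \<mu>)"
  proof (rule has_real_derivative_If_closed[where T = ?T])
    show "closed ?S" "closed ?T"
      by (intro closed_Collect_le continuous_intros)+
    show "?S \<union> ?T = UNIV" by auto
    show "((\<lambda>m. 4 * \<tau>\<^sup>2) has_real_derivative 0) (at \<mu>)"
      by simp
    show "((\<lambda>m. (m\<^sup>2 + \<tau>\<^sup>2)\<^sup>2 / m\<^sup>2) has_real_derivative 2 * ((\<mu> ^ 4 - \<tau> ^ 4) / \<mu> ^ 3)) (at \<mu>)"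
      if "\<mu> \<in> ?T"
    proof -
      have "\<mu> \<noteq> 0" using that False by auto
      then show ?thesis
        by (auto intro!: derivative_eq_intros simp: field_simps eval_nat_numeral)
    qed
    show "4 * \<tau>\<^sup>2 = (\<mu>\<^sup>2 + \<tau>\<^sup>2)\<^sup>2 / \<mu>\<^sup>2 \<and> 0 = 2 * ((\<mu> ^ 4 - \<tau> ^ 4) / \<mu> ^ 3)"
      if "\<mu> \<in> ?S" "\<mu> \<in> ?T"
    proof -
      have "\<mu> ^ 4 = \<tau> ^ 4"
        using sq[OF that] by (metis power_even_eq numeral_Bit0 mult_2)
      then show ?thesis
        using False sq[OF that] by (simp add: power2_eq_square)
    qed
  qed
  then show ?thesis
    unfolding eq by (auto simp: not_less split: if_splits)
qed

lemma dQbar_d\<tau>_eq: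
  "dQbar_d\<tau> \<mu> \<tau> = (if \<bar>\<mu>\<bar> > \<bar>\<tau>\<bar> then 4 * \<tau> * ((\<mu>\<^sup>2 + \<tau>\<^sup>2) / \<mu>\<^sup>2) else 8 * \<tau>)"
  unfolding dQbar_d\<tau>_def by (rule DERIV_imp_deriv[OF Qbar_partial_\<tau>])

lemma dQbar_d\<mu>_eq:
  "dQbar_d\<mu> \<mu> \<tau> = (if \<bar>\<mu>\<bar> > \<bar>\<tau>\<bar> then 2 * ((\<mu> ^ 4 - \<tau> ^ 4) / \<mu> ^ 3) else 0)"
  unfolding dQbar_d\<mu>_def by (rule DERIV_imp_deriv[OF Qbar_partial_\<mu>])

section \<open>The equilibrium boundary value problem\<close>

text \<open>The directors are the columns of \<open>r\<^sup>T\<close>.\<close>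

definition director :: "(real \<Rightarrow> real^3^3) \<Rightarrow> 3 \<Rightarrow> real \<Rightarrow> real^3" where
  "director r i s = column i (transpose (r s))"

definition director_deriv :: "real \<Rightarrow> (real \<Rightarrow> real^3^3) \<Rightarrow> 3 \<Rightarrow> real \<Rightarrow> real^3" where
  "director_deriv l r i = weak_derivative {0<..<l} (director r i)"

definition curvature :: "real \<Rightarrow> (real \<Rightarrow> real^3^3) \<Rightarrow> real \<Rightarrow> real" where
  "curvature l r s = director_deriv l r 1 s \<bullet> director r 3 s"

definition torsion :: "real \<Rightarrow> (real \<Rightarrow> real^3^3) \<Rightarrow> real \<Rightarrow> real" where
  "torsion l r s = - (director_deriv l r 2 s \<bullet> director r 3 s)"

text \<open>Sobolev functions on \<open>(0, l)\<close> are identified with their continuous representatives on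
  \<open>[0, l]\<close>, so that the boundary conditions and the pointwise constraint \<open>r s \<in> SO(3)\<close>
  make sense.\<close>

definition equilibrium_solution ::
    "real \<Rightarrow> real^3 \<Rightarrow> real^3^3 \<Rightarrow> (real \<Rightarrow> real^3) \<Rightarrow> (real \<Rightarrow> real^3^3) \<Rightarrow> bool" where
  "equilibrium_solution l ybar rbar y r \<longleftrightarrow>
     continuous_on {0..l} y \<and> W22_on {0<..<l} y \<and>
     continuous_on {0..l} r \<and> W12_on {0<..<l} r \<and>
     (\<forall>s\<in>{0..l}. rotation_matrix (r s)) \<and>
     (AE s in lebesgue_on {0<..<l}. weak_derivative {0<..<l} y s = director r 1 s) \<and>
     (\<exists>lam1 lam2 :: real^3.
        (AE s in lebesgue_on {0<..<l}.
           dQbar_d\<tau> (curvature l r s) (torsion l r s)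
             = (lam2 + cross3 lam1 (y s)) \<bullet> director r 1 s) \<and>
        (AE s in lebesgue_on {0<..<l}.
           dQbar_d\<mu> (curvature l r s) (torsion l r s)
             = (lam2 + cross3 lam1 (y s)) \<bullet> director r 2 s)) \<and>
     (AE s in lebesgue_on {0<..<l}. director_deriv l r 1 s \<bullet> director r 2 s = 0) \<and>
     y 0 = 0 \<and> y l = ybar \<and> r 0 = mat 1 \<and> r l = rbar"

definition regular_solution ::
    "real \<Rightarrow> real^3 \<Rightarrow> real^3^3 \<Rightarrow> (real \<Rightarrow> real^3) \<Rightarrow> (real \<Rightarrow> real^3^3) \<Rightarrow> bool" where
  "regular_solution l ybar rbar y r \<longleftrightarrow>
     equilibrium_solution l ybar rbar y r \<and>
     (\<exists>F :: real set set.
        (\<forall>J\<in>F. \<exists>a b. 0 \<le> a \<and> a < b \<and> b \<le> l \<and> J = {a<..<b}) \<and>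
        pairwise disjnt F \<and>
        {0<..<l} - \<Union>F \<in> null_sets lebesgue \<and>
        (\<forall>J\<in>F. (AE s in lebesgue_on J. curvature l r s > 0) \<or>
                (AE s in lebesgue_on J. curvature l r s < 0) \<or>
                (AE s in lebesgue_on J. curvature l r s = 0)))"

definition matrix_of_columns :: "real^3 \<Rightarrow> real^3 \<Rightarrow> real^3 \<Rightarrow> real^3^3" where
  "matrix_of_columns a b c = transpose (vector [a, b, c])"

end

theory Submission
  imports Defs
begin

text \<open>Put \<open>M = \<lambda>\<^sub>2 + \<lambda>\<^sub>1 \<and> y\<close> and \<open>t = M \<cdot> d\<^sub>1\<close>, and suppose that \<open>d\<^sub>1 \<cdot> k = 0\<close>. Since \<open>M' = \<lambda>\<^sub>1 \<and> d\<^sub>1\<close> is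
  orthogonal to \<open>d\<^sub>1\<close>, the weak derivative of \<open>t\<close> is \<open>M \<cdot> d\<^sub>1'\<close>, where \<open>d\<^sub>1' = \<mu> d\<^sub>3\<close>. It vanishes on the
  intervals where \<open>\<mu> = 0\<close>. On the intervals where \<open>\<mu> \<noteq> 0\<close>, differentiating \<open>d\<^sub>1 \<cdot> k = 0\<close> gives
  \<open>d\<^sub>3 \<cdot> k = 0\<close>, so \<open>d\<^sub>2 = \<plusminus>k\<close> and \<open>\<tau> = 0\<close>; the first equilibrium equation then gives \<open>t = 0\<close>, so that
  again \<open>t' = 0\<close>. Hence \<open>t\<close> is constant. If \<open>\<mu>\<close> vanished a.e., the curve would be a segment and could
  not close up; so there is an interval with \<open>\<mu> \<noteq> 0\<close>, and \<open>t\<close> vanishes identically. By the first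
  equilibrium equation \<open>\<tau> = 0\<close> a.e., hence \<open>d\<^sub>2' = 0\<close> and \<open>d\<^sub>2\<close> is constant, contradicting
  \<open>d\<^sub>2(0) = e\<^sub>2\<close> and \<open>d\<^sub>2(\<ell>) = -e\<^sub>2\<close>.\<close>

subsection \<open>Smooth cut-off functions\<close>

text \<open>The derivative 6x(1 - x) of the cubic vanishes at 0 and 1, so the three pieces join in a
  C1 way, which is the smoothness that \<open>C1_test_function\<close> asks for. Membership in
  closed rays is the form that \<open>has_real_derivative_If_closed\<close> takes.\<close>

definition smoothstep :: "real \<Rightarrow> real" where
  "smoothstep x = (if x \<in> {..0} then 0 else if x \<in> {..1} then 3 * x\<^sup>2 - 2 * x ^ 3 else 1)"

text \<open>Clamping x to [0, 1] covers all three pieces by one formula, from which continuity is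
  immediate.\<close>

definition smoothstep_deriv :: "real \<Rightarrow> real" where
  "smoothstep_deriv x = 6 * max 0 (min 1 x) * (1 - max 0 (min 1 x))"

lemma has_real_derivative_smoothstep:
  "(smoothstep has_real_derivative smoothstep_deriv x) (at x)"
proof -
  have inner: "((\<lambda>x. if x \<in> {..1} then 3 * x\<^sup>2 - 2 * x ^ 3 else 1) has_real_derivative
      (if x \<in> {..1} then 6 * x * (1 - x) else 0)) (at x)" for x :: real
    by (rule has_real_derivative_If_closed[where T = "{1..}"])
      (auto intro!: derivative_eq_intros simp: power2_eq_square algebra_simps)
  have "((\<lambda>x. if x \<in> {..0} then 0 else if x \<in> {..1} then 3 * x\<^sup>2 - 2 * x ^ 3 else 1)
      has_real_derivative
      (if x \<in> {..0} then 0 else if x \<in> {..1} then 6 * x * (1 - x) else 0)) (at x)"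
    by (rule has_real_derivative_If_closed[where T = "{0..}", OF _ _ _ _ inner]) auto
  moreover have "smoothstep = (\<lambda>x. if x \<in> {..0} then 0 else if x \<in> {..1} then 3 * x\<^sup>2 - 2 * x ^ 3 else 1)"
    by (auto simp: smoothstep_def)
  moreover have "(if x \<in> {..0} then 0 else if x \<in> {..1} then 6 * x * (1 - x) else 0) = smoothstep_deriv x"
    by (auto simp: smoothstep_deriv_def)
  ultimately show ?thesis by simp
qed

lemma continuous_on_smoothstep_deriv: "continuous_on A smoothstep_deriv"
  unfolding smoothstep_deriv_def by (intro continuous_intros)

lemma smoothstep_deriv_nonneg: "0 \<le> smoothstep_deriv x"
  by (simp add: smoothstep_deriv_def)

lemma smoothstep_deriv_eq_0: "x \<le> 0 \<or> 1 \<le> x \<Longrightarrow> smoothstep_deriv x = 0"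
  by (auto simp: smoothstep_deriv_def)

lemma smoothstep_bounds: "0 \<le> smoothstep x" "smoothstep x \<le> 1"
proof -
  have mono: "smoothstep a \<le> smoothstep b" if "a \<le> b" for a b
    by (rule DERIV_nonneg_imp_nondecreasing[OF that])
      (use has_real_derivative_smoothstep smoothstep_deriv_nonneg in blast)
  show "0 \<le> smoothstep x" using mono[of "min 0 x" x] by (simp add: smoothstep_def)
  show "smoothstep x \<le> 1" using mono[of x "max 2 x"] by (simp add: smoothstep_def split: if_splits)
qed

lemma smoothstep_eq_0: "x \<le> 0 \<Longrightarrow> smoothstep x = 0"
  and smoothstep_eq_1: "1 \<le> x \<Longrightarrow> smoothstep x = 1"
  by (auto simp: smoothstep_def)

lemma has_real_derivative_smoothstep_scaled:
  "((\<lambda>x. smoothstep (n * (x - e))) has_real_derivative n * smoothstep_deriv (n * (x - e))) (at x within A)"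
proof -
  have "((\<lambda>x. n * (x - e)) has_real_derivative n) (at x within A)"
    by (auto intro!: derivative_eq_intros)
  from DERIV_chain2[OF has_real_derivative_smoothstep this] show ?thesis
    by (simp add: mult.commute)
qed

text \<open>The weights are nonnegative, live on [e, e + 1/n] and have mass 1 once n is large. They
  lie to the right of e, which is why e may equal a but must stay below c.\<close>

lemma smoothstep_deriv_approximate_identity:
  fixes f :: "real \<Rightarrow> 'a::euclidean_space"
  assumes f: "continuous_on {a..c} f" and e: "a \<le> e" "e < c"
  shows "(\<lambda>n. integral {a..c} (\<lambda>x. (real n * smoothstep_deriv (real n * (x - e))) *\<^sub>R f x))
    \<longlonglongrightarrow> f e"
proof (rule LIMSEQ_I)
  fix \<epsilon> :: real assume "\<epsilon> > 0"
  define w where "w n x = real n * smoothstep_deriv (real n * (x - e))" for n x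
  have wcont: "continuous_on A (w n)" for A n
    unfolding w_def by (intro continuous_intros continuous_on_compose2[OF continuous_on_smoothstep_deriv]) auto
  obtain d where d: "d > 0" "\<And>x. x \<in> {a..c} \<Longrightarrow> dist x e < d \<Longrightarrow> dist (f x) (f e) < \<epsilon> / 2"
    using f e \<open>\<epsilon> > 0\<close> unfolding continuous_on_iff
    by (metis atLeastAtMost_iff half_gt_zero less_eq_real_def)
  \<comment> \<open>The first bound puts the support of the weight within distance d of e, the
    second inside [a, c], so that no mass is lost.\<close>
  obtain N :: nat where N: "real N > max (1 / d) (1 / (c - e))"
    using reals_Archimedean2 by blast
  show "\<exists>no. \<forall>n\<ge>no. norm (integral {a..c} (\<lambda>x. (real n * smoothstep_deriv (real n * (x - e))) *\<^sub>R f x) - f e) < \<epsilon>"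
  proof (intro exI allI impI)
    fix n assume n: "n \<ge> N"
    then have n': "real n > 1 / d" "real n > 1 / (c - e)" using N by auto
    then have npos: "real n > 0" using d(1) by (smt (verit) zero_less_divide_1_iff)
    have one: "(w n has_integral 1) {a..c}"
    proof -
      have "(w n has_integral smoothstep (real n * (c - e)) - smoothstep (real n * (a - e))) {a..c}"
        by (rule fundamental_theorem_of_calculus)
          (use e has_real_derivative_smoothstep_scaled in
            \<open>auto simp: w_def has_real_derivative_iff_has_vector_derivative[symmetric]\<close>)
      moreover have "1 \<le> real n * (c - e)"
        using n'(2) e by (simp add: field_simps)
      moreover have "real n * (a - e) \<le> 0" using e npos by (simp add: mult_le_0_iff)
      ultimately show ?thesis by (simp add: smoothstep_eq_0 smoothstep_eq_1)
    qed
    have int: "(\<lambda>x. w n x *\<^sub>R f x) integrable_on {a..c}"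
      by (intro integrable_continuous_real continuous_intros wcont f)
    \<comment> \<open>As the weight has mass 1, f e is the weighted integral of the constant f
      e.\<close>
    have "integral {a..c} (\<lambda>x. w n x *\<^sub>R f x) - f e
        = integral {a..c} (\<lambda>x. w n x *\<^sub>R f x) - integral {a..c} (\<lambda>x. w n x *\<^sub>R f e)"
      using has_integral_scaleR_left[OF one, of "f e"] by (simp add: integral_unique)
    also have "\<dots> = integral {a..c} (\<lambda>x. w n x *\<^sub>R f x - w n x *\<^sub>R f e)"
      by (rule integral_diff[symmetric, OF int])
        (intro integrable_continuous_real continuous_intros wcont)
    also have "norm \<dots> \<le> integral {a..c} (\<lambda>x. w n x * (\<epsilon> / 2))"
    proof (rule integral_norm_bound_integral)
      show "(\<lambda>x. w n x *\<^sub>R f x - w n x *\<^sub>R f e) integrable_on {a..c}"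
        by (intro integrable_continuous_real continuous_intros wcont f)
      show "(\<lambda>x. w n x * (\<epsilon> / 2)) integrable_on {a..c}"
        by (intro integrable_continuous_real continuous_intros wcont)
      fix x assume x: "x \<in> {a..c}"
      have w0: "w n x \<ge> 0" by (simp add: w_def smoothstep_deriv_nonneg)
      show "norm (w n x *\<^sub>R f x - w n x *\<^sub>R f e) \<le> w n x * (\<epsilon> / 2)"
      proof (cases "dist x e < d")
        case True
        then have "norm (f x - f e) \<le> \<epsilon> / 2" using d(2)[OF x] by (simp add: dist_norm)
        moreover have "norm (w n x *\<^sub>R f x - w n x *\<^sub>R f e) = w n x * norm (f x - f e)"
          using w0 by (metis abs_of_nonneg norm_scaleR scaleR_diff_right)
        ultimately show ?thesis using w0 mult_left_mono by metis
      next
        case False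
        \<comment> \<open>At distance at least d from e the argument of the kernel lies outside (0,
          1), where the kernel vanishes.\<close>
        have "real n * (x - e) \<le> 0 \<or> 1 \<le> real n * (x - e)"
        proof (cases "x \<le> e")
          case True then show ?thesis using npos by (simp add: mult_le_0_iff)
        next
          case F: False
          then have "d \<le> x - e" using False by (simp add: dist_real_def)
          moreover have "1 \<le> real n * d" using n'(1) d(1) by (simp add: field_simps)
          ultimately show ?thesis using npos by (smt (verit) mult_left_mono)
        qed
        then have "w n x = 0" by (simp add: w_def smoothstep_deriv_eq_0)
        then show ?thesis by simp
      qed
    qed
    also have "\<dots> = \<epsilon> / 2"
      using has_integral_mult_left[OF one, of "\<epsilon> / 2"] by (metis integral_unique mult_1)
    also have "\<dots> < \<epsilon>" using \<open>\<epsilon> > 0\<close> by simp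
    finally show "norm (integral {a..c} (\<lambda>x. (real n * smoothstep_deriv (real n * (x - e))) *\<^sub>R f x) - f e) < \<epsilon>"
      by (simp add: w_def)
  qed
qed

section \<open>Integrability against continuous weights and test functions\<close>

lemma compact_imp_lebesgue_set: "compact K \<Longrightarrow> K \<in> sets lebesgue" for K :: "real set"
  by (simp add: fmeasurableD lmeasurable_compact)

text \<open>A continuous weight is bounded on a compact set, so a multiple of f dominates the
  product.\<close>

lemma integrable_continuous_scaleR:
  fixes f :: "real \<Rightarrow> 'a::euclidean_space"
  assumes K: "compact K" and \<psi>: "continuous_on K (\<psi> :: real \<Rightarrow> real)" and f: "integrable (lebesgue_on K) f"
  shows "integrable (lebesgue_on K) (\<lambda>x. \<psi> x *\<^sub>R f x)"
proof -
  have Ks: "K \<in> sets lebesgue" using K compact_imp_lebesgue_set by blast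
  obtain C where C: "\<And>x. x \<in> K \<Longrightarrow> norm (\<psi> x) \<le> C"
    using compact_imp_bounded[OF compact_continuous_image[OF \<psi> K]] by (auto simp: bounded_iff)
  have [measurable]: "\<psi> \<in> borel_measurable (lebesgue_on K)"
    by (rule continuous_imp_measurable_on_sets_lebesgue[OF \<psi> Ks])
  have [measurable]: "f \<in> borel_measurable (lebesgue_on K)" using f by auto
  show ?thesis
  proof (rule Bochner_Integration.integrable_bound)
    show "integrable (lebesgue_on K) (\<lambda>x. C *\<^sub>R f x)" using f by simp
    show "AE x in lebesgue_on K. norm (\<psi> x *\<^sub>R f x) \<le> norm (C *\<^sub>R f x)"
      using C by (intro AE_I2) (fastforce intro: mult_right_mono order_trans[OF _ abs_ge_self])
  qed measurable
qed

lemma lebesgue_on_support: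
  fixes h :: "real \<Rightarrow> 'a::euclidean_space"
  assumes "K \<in> sets lebesgue" "I \<in> sets lebesgue" "K \<subseteq> I" "\<And>x. x \<notin> K \<Longrightarrow> h x = 0"
  shows "integrable (lebesgue_on I) h \<longleftrightarrow> integrable (lebesgue_on K) h"
    and "integral\<^sup>L (lebesgue_on I) h = integral\<^sup>L (lebesgue_on K) h"
proof -
  have "(\<lambda>x. indicator I x *\<^sub>R h x) = (\<lambda>x. indicator K x *\<^sub>R h x)"
    using assms by (auto simp: indicator_def fun_eq_iff)
  then show "integrable (lebesgue_on I) h \<longleftrightarrow> integrable (lebesgue_on K) h"
    and "integral\<^sup>L (lebesgue_on I) h = integral\<^sup>L (lebesgue_on K) h"
    using assms by (simp_all add: integrable_restrict_space integral_restrict_space)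
qed

text \<open>The derivative also vanishes off K: the complement of K is open, so the function is 0 in
  a whole neighbourhood there. Thus both integrals in the definition of the weak derivative live on
  K.\<close>

lemma C1_test_functionD:
  assumes "C1_test_function I \<phi>"
  obtains K where "compact K" "K \<subseteq> I" "\<And>x. x \<notin> K \<Longrightarrow> \<phi> x = 0" "\<And>x. x \<notin> K \<Longrightarrow> deriv \<phi> x = 0"
    "\<And>x. (\<phi> has_real_derivative deriv \<phi> x) (at x)" "continuous_on UNIV (deriv \<phi>)"
    "continuous_on UNIV \<phi>"
proof -
  obtain D where D: "\<And>x. (\<phi> has_vector_derivative D x) (at x)" "continuous_on UNIV D"
    using assms by (auto simp: C1_test_function_def C1_differentiable_on_def)
  obtain K where K: "compact K" "K \<subseteq> I" "\<And>x. x \<notin> K \<Longrightarrow> \<phi> x = 0"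
    using assms by (auto simp: C1_test_function_def)
  have d: "(\<phi> has_real_derivative D x) (at x)" for x
    using D(1) by (simp add: has_real_derivative_iff_has_vector_derivative)
  then have dD: "deriv \<phi> = D" by (auto simp: DERIV_imp_deriv)
  have "deriv \<phi> x = 0" if "x \<notin> K" for x
  proof (rule DERIV_imp_deriv)
    have "\<forall>\<^sub>F y in nhds x. \<phi> y = 0"
      using that K compact_imp_closed[OF K(1)]
      by (auto simp: eventually_nhds intro!: exI[of _ "-K"])
    then show "(\<phi> has_real_derivative 0) (at x)"
      by (subst DERIV_cong_ev[OF refl _ refl, of _ "\<lambda>_. 0"]) auto
  qed
  moreover have "continuous_on UNIV \<phi>"
    using d DERIV_isCont by (auto simp: continuous_on_eq_continuous_at)
  ultimately show thesis using that[OF K(1,2,3)] d D(2) dD by simp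
qed

lemma test_function_integrable:
  fixes f :: "real \<Rightarrow> 'a::euclidean_space"
  assumes I: "I \<in> sets lebesgue" and f: "locally_integrable_on I f" and K: "compact K" "K \<subseteq> I"
    and \<psi>: "\<And>x. x \<notin> K \<Longrightarrow> \<psi> x = 0" "continuous_on UNIV \<psi>"
  shows "integrable (lebesgue_on I) (\<lambda>x. (\<psi> x :: real) *\<^sub>R f x)"
proof (subst lebesgue_on_support(1)[of K])
  show "integrable (lebesgue_on K) (\<lambda>x. \<psi> x *\<^sub>R f x)"
    using f K \<psi>(2) by (intro integrable_continuous_scaleR) (auto simp: locally_integrable_on_def intro: continuous_on_subset)
qed (use assms compact_imp_lebesgue_set in auto)

subsection \<open>Weak derivatives on an interval\<close>

text \<open>Lebesgue measure is complete, so the exceptional set, a priori only contained in a null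
  set, is negligible itself.\<close>

lemma AE_lebesgue_on_iff:
  "S \<in> sets lebesgue \<Longrightarrow> (AE x in lebesgue_on S. P x) \<longleftrightarrow> negligible {x\<in>S. \<not> P x}"
proof -
  assume S: "S \<in> sets lebesgue"
  have "(AE x in lebesgue_on S. P x) \<longleftrightarrow> (\<exists>N. negligible N \<and> {x\<in>S. \<not> P x} \<subseteq> N)"
    using S by (subst AE_restrict_space_iff)
      (auto simp: eventually_ae_filter negligible_iff_null_sets Bex_def Collect_conj_eq)
  then show ?thesis using negligible_subset by blast
qed

text \<open>The test functions increase to 1 just right of \<open>a\<close> and decrease to 0 just right of \<open>b\<close>, and
  converge to the indicator of \<open>(a, b]\<close>.\<close>

lemma has_weak_derivative_on_has_integral:
  fixes f :: "real \<Rightarrow> 'a::euclidean_space"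
  assumes w: "has_weak_derivative_on f g {p<..<q}" and f: "continuous_on {p<..<q} f"
    and ab: "p < a" "a \<le> b" "b < q"
  shows "(g has_integral (f b - f a)) {a..b}"
proof -
  let ?I = "{p<..<q}"
  \<comment> \<open>The test functions come down to 0 on [b, b + 1/n]; c leaves room for this
    descent before q.\<close>
  define c where "c = (b + q) / 2"
  have c: "b < c" "c < q" using ab by (auto simp: c_def)
  define \<phi> where "\<phi> n x = smoothstep (real n * (x - a)) - smoothstep (real n * (x - b))" for n x
  define \<phi>' where "\<phi>' n x = real n * smoothstep_deriv (real n * (x - a))
    - real n * smoothstep_deriv (real n * (x - b))" for n x
  have sub: "{a..c} \<subseteq> ?I" using ab c by auto
  have gint: "integrable (lebesgue_on {a..c}) g" and fint: "integrable (lebesgue_on {a..c}) f"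
    using w sub by (auto simp: has_weak_derivative_on_def locally_integrable_on_def)
  have fc: "continuous_on {a..c} f" using f sub continuous_on_subset by blast
  have d\<phi>: "(\<phi> n has_real_derivative \<phi>' n x) (at x)" for n x
    unfolding \<phi>_def[abs_def] \<phi>'_def
    by (intro DERIV_diff has_real_derivative_smoothstep_scaled)
  then have deriv\<phi>: "deriv (\<phi> n) = \<phi>' n" for n by (auto intro!: DERIV_imp_deriv)
  have \<phi>'cont: "continuous_on A (\<phi>' n)" for A n
    unfolding \<phi>'_def[abs_def]
    by (intro continuous_intros continuous_on_compose2[OF continuous_on_smoothstep_deriv]) auto
  have \<phi>cont: "continuous_on A (\<phi> n)" for A n
    using d\<phi> DERIV_isCont continuous_at_imp_continuous_on by blast
  have \<phi>bound: "\<bar>\<phi> n x\<bar> \<le> 1" for n x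
    using smoothstep_bounds[of "real n * (x - a)"] smoothstep_bounds[of "real n * (x - b)"]
    unfolding \<phi>_def by linarith
  obtain N :: nat where N: "real N > 1 / (c - b)"
    using reals_Archimedean2 by blast
  have out: "\<phi> n x = 0 \<and> \<phi>' n x = 0" if "n \<ge> N" "x \<notin> {a..c}" for n x
  proof (cases "x < a")
    case True
    then have "real n * (x - a) \<le> 0" "real n * (x - b) \<le> 0"
      using ab by (auto simp: mult_le_0_iff)
    then show ?thesis by (simp add: \<phi>_def \<phi>'_def smoothstep_eq_0 smoothstep_deriv_eq_0)
  next
    case False
    then have x: "x > c" using that by auto
    have "real n > 1 / (c - b)" using N that(1) by auto
    then have 1: "real n * (c - b) \<ge> 1" using c by (simp add: field_simps)
    have "real n * (x - b) \<ge> real n * (c - b)" "real n * (x - a) \<ge> real n * (c - b)"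
      using x ab by (auto intro!: mult_left_mono)
    then have "1 \<le> real n * (x - a)" "1 \<le> real n * (x - b)" using 1 by auto
    then show ?thesis by (simp add: \<phi>_def \<phi>'_def smoothstep_eq_1 smoothstep_deriv_eq_0)
  qed
  have test: "C1_test_function ?I (\<phi> n)" if "n \<ge> N" for n
    unfolding C1_test_function_def C1_differentiable_on_def
  proof (intro conjI exI ballI)
    show "(\<phi> n has_vector_derivative \<phi>' n x) (at x)" for x
      using d\<phi> by (simp add: has_real_derivative_iff_has_vector_derivative)
    show "\<forall>x. x \<notin> {a..c} \<longrightarrow> \<phi> n x = 0" using out that by blast
  qed (use \<phi>'cont sub in auto)
  have key: "integral {a..c} (\<lambda>x. \<phi>' n x *\<^sub>R f x) = - (LINT x|lebesgue_on {a..c}. \<phi> n x *\<^sub>R g x)" if n: "n \<ge> N" for n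
  proof -
    have "(LINT x|lebesgue_on ?I. deriv (\<phi> n) x *\<^sub>R f x) = - (LINT x|lebesgue_on ?I. \<phi> n x *\<^sub>R g x)"
      using w test[OF n] unfolding has_weak_derivative_on_def by blast
    then have "(LINT x|lebesgue_on ?I. \<phi>' n x *\<^sub>R f x) = - (LINT x|lebesgue_on ?I. \<phi> n x *\<^sub>R g x)"
      by (simp only: deriv\<phi>)
    moreover have "(LINT x|lebesgue_on ?I. \<phi>' n x *\<^sub>R f x) = (LINT x|lebesgue_on {a..c}. \<phi>' n x *\<^sub>R f x)"
      by (rule lebesgue_on_support(2)) (use sub out[OF n] in auto)
    moreover have "(LINT x|lebesgue_on ?I. \<phi> n x *\<^sub>R g x) = (LINT x|lebesgue_on {a..c}. \<phi> n x *\<^sub>R g x)"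
      by (rule lebesgue_on_support(2)) (use sub out[OF n] in auto)
    moreover have "(LINT x|lebesgue_on {a..c}. \<phi>' n x *\<^sub>R f x) = integral {a..c} (\<lambda>x. \<phi>' n x *\<^sub>R f x)"
      by (intro lebesgue_integral_eq_integral integrable_continuous_scaleR fint \<phi>'cont) auto
    ultimately show ?thesis by simp
  qed
  have "(\<lambda>n. integral {a..c} (\<lambda>x. \<phi>' n x *\<^sub>R f x)) \<longlonglongrightarrow> f a - f b"
  proof -
    let ?w = "\<lambda>e n x. (real n * smoothstep_deriv (real n * (x - e))) *\<^sub>R f x"
    have "integral {a..c} (\<lambda>x. \<phi>' n x *\<^sub>R f x) = integral {a..c} (?w a n) - integral {a..c} (?w b n)" for n
      unfolding \<phi>'_def scaleR_diff_left
      by (intro integral_diff integrable_continuous_real continuous_intros fc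
          continuous_on_compose2[OF continuous_on_smoothstep_deriv]) auto
    then show ?thesis
      using tendsto_diff[OF smoothstep_deriv_approximate_identity[OF fc, of a] smoothstep_deriv_approximate_identity[OF fc, of b]]
        ab c by simp
  qed
  \<comment> \<open>Dominated convergence with majorant \<open>norm (g x)\<close>, as the test
    functions are bounded by 1. Their limit is 0 at a and 1 at b because
    \<open>smoothstep 0 = 0\<close>, hence the half-open interval.\<close>
  moreover have "(\<lambda>n. integral {a..c} (\<lambda>x. \<phi>' n x *\<^sub>R f x))
      \<longlonglongrightarrow> - (LINT x|lebesgue_on {a..c}. indicator {a<..b} x *\<^sub>R g x)"
  proof -
    have "(\<lambda>n. LINT x|lebesgue_on {a..c}. \<phi> n x *\<^sub>R g x)
      \<longlonglongrightarrow> (LINT x|lebesgue_on {a..c}. indicator {a<..b} x *\<^sub>R g x)"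
    proof (rule integral_dominated_convergence[where w = "\<lambda>x. norm (g x)"])
      have [measurable]: "g \<in> borel_measurable (lebesgue_on {a..c})" using gint by auto
      have ind: "indicator {a<..b} \<in> borel_measurable (lebesgue_on {a..c})"
        by (intro measurable_restrict_space1 borel_measurable_indicator) simp
      show "(\<lambda>x. indicator {a<..b} x *\<^sub>R g x) \<in> borel_measurable (lebesgue_on {a..c})"
        using ind by measurable
      show "(\<lambda>x. \<phi> n x *\<^sub>R g x) \<in> borel_measurable (lebesgue_on {a..c})" for n
        using integrable_continuous_scaleR[OF _ \<phi>cont gint] by auto
      show "integrable (lebesgue_on {a..c}) (\<lambda>x. norm (g x))" using gint by simp
      show "AE x in lebesgue_on {a..c}. norm (\<phi> n x *\<^sub>R g x) \<le> norm (g x)" for n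
        using mult_right_mono[OF \<phi>bound] by (intro AE_I2) fastforce
      have lim: "(\<lambda>n. smoothstep (real n * t)) \<longlonglongrightarrow> indicator {0<..} t" for t :: real
      proof (cases "t > 0")
        case True
        obtain M :: nat where M: "real M > 1 / t" using reals_Archimedean2 by blast
        have "smoothstep (real n * t) = 1" if "n \<ge> M" for n
        proof (rule smoothstep_eq_1)
          have "real n > 1 / t" using M that by auto
          then show "1 \<le> real n * t" using True by (simp add: field_simps)
        qed
        then show ?thesis using True
          by (intro tendsto_eventually) (auto simp: eventually_sequentially)
      next
        case False
        then have "smoothstep (real n * t) = 0" for n
          by (intro smoothstep_eq_0) (auto simp: mult_le_0_iff)
        then show ?thesis using False by simp
      qed
      show "AE x in lebesgue_on {a..c}. (\<lambda>n. \<phi> n x *\<^sub>R g x) \<longlonglongrightarrow> indicator {a<..b} x *\<^sub>R g x"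
      proof (intro AE_I2 tendsto_scaleR tendsto_const)
        fix x
        have "(\<lambda>n. \<phi> n x) \<longlonglongrightarrow> indicator {0<..} (x - a) - indicator {0<..} (x - b)"
          unfolding \<phi>_def by (intro tendsto_diff lim)
        moreover have "indicator {0<..} (x - a) - indicator {0<..} (x - b) = (indicator {a<..b} x :: real)"
          using ab by (auto simp: indicator_def)
        ultimately show "(\<lambda>n. \<phi> n x) \<longlonglongrightarrow> indicator {a<..b} x" by simp
      qed
    qed
    from tendsto_minus[OF this] show ?thesis
      by (rule Lim_transform_eventually) (auto simp: eventually_sequentially key intro!: exI[of _ N])
  qed
  ultimately have "f a - f b = - (LINT x|lebesgue_on {a..c}. indicator {a<..b} x *\<^sub>R g x)"
    by (rule LIMSEQ_unique)
  then have eq: "f b - f a = (LINT x|lebesgue_on {a..c}. indicator {a<..b} x *\<^sub>R g x)"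
    by (simp add: minus_equation_iff[of "f a - f b"] minus_diff_eq eq_neg_iff_add_eq_0 algebra_simps)
  have gab: "integrable (lebesgue_on {a<..b}) g"
  proof -
    have "integrable lebesgue (\<lambda>x. indicator {a<..b} x *\<^sub>R (indicator {a..c} x *\<^sub>R g x))"
      by (rule integrable_mult_indicator) (use gint in \<open>auto simp: integrable_restrict_space\<close>)
    also have "(\<lambda>x. indicator {a<..b} x *\<^sub>R (indicator {a..c} x *\<^sub>R g x)) = (\<lambda>x. indicator {a<..b} x *\<^sub>R g x)"
      using c by (auto simp: indicator_def)
    finally show ?thesis by (simp add: integrable_restrict_space)
  qed
  have "f b - f a = (LINT x|lebesgue_on {a<..b}. g x)"
    unfolding eq using c
    by (subst (1 2) integral_restrict_space)
      (auto simp: indicator_def intro!: Bochner_Integration.integral_cong)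
  then have "(g has_integral f b - f a) {a<..b}"
    using has_integral_integral_lebesgue_on[OF gab] by simp
  moreover have spike: "negligible {x \<in> {a<..b} - {a..b}. g x \<noteq> 0}"
    "negligible {x \<in> {a..b} - {a<..b}. g x \<noteq> 0}"
    by (rule negligible_subset[of "{a}"]; force)+
  ultimately show ?thesis using has_integral_spike_set_eq[OF spike] by blast
qed

text \<open>One-sided, because the Lebesgue differentiation theorem of the library averages over
  intervals \<open>[x, x + h]\<close>; this is enough to differentiate pointwise identities.\<close>

lemma has_weak_derivative_on_AE_right_derivative:
  fixes f :: "real \<Rightarrow> 'a::euclidean_space"
  assumes w: "has_weak_derivative_on f g {p<..<q}" and f: "continuous_on {p<..<q} f"
  shows "AE x in lebesgue_on {p<..<q}. (f has_vector_derivative g x) (at x within {x..})"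
proof -
  \<comment> \<open>Compact subintervals come first, since g is only locally integrable in (p,
    q).\<close>
  have loc: "\<exists>N. negligible N \<and> (\<forall>x. x \<in> {a..<b} - N \<longrightarrow> (f has_vector_derivative g x) (at x within {x..}))"
    if ab: "p < a" "b < q" for a b
  proof (cases "a \<le> b")
    case True
    \<comment> \<open>The differentiation theorem is applied to a function integrable on every box.
      For x < b, small averages to the right of x do not see the truncation.\<close>
    define G where "G x = (if x \<in> {a..b} then g x else 0)" for x
    have "G integrable_on UNIV"
      unfolding G_def using has_weak_derivative_on_has_integral[OF w f ab(1) True ab(2)]
      by (subst integrable_restrict_UNIV) (auto simp: integrable_on_def)
    then have "G integrable_on cbox u v" for u v
      using integrable_on_subcbox by blast
    then obtain N where N: "negligible N"
      "\<And>x e. \<lbrakk>x \<notin> N; 0 < e\<rbrakk> \<Longrightarrow> \<exists>d>0. \<forall>h. 0 < h \<and> h < d \<longrightarrow>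
          norm (integral (cbox x (x + h *\<^sub>R One)) G /\<^sub>R h ^ DIM(real) - G x) < e"
      using integrable_ccontinuous_explicit[of G] by blast
    have "(f has_vector_derivative g x) (at x within {x..})" if x: "x \<in> {a..<b} - N" for x
      unfolding has_vector_derivative_def has_derivative_within_alt
    proof (intro conjI allI impI)
      show "bounded_linear (\<lambda>h. h *\<^sub>R g x)" by (rule bounded_linear_scaleR_left)
      fix e :: real assume "e > 0"
      then obtain d where d: "d > 0" "\<And>h. 0 < h \<Longrightarrow> h < d \<Longrightarrow>
          norm (integral {x..x + h} G /\<^sub>R h - G x) < e"
        using N(2)[of x e] x by auto
      show "\<exists>d>0. \<forall>y\<in>{x..}. norm (y - x) < d \<longrightarrow> norm (f y - f x - (y - x) *\<^sub>R g x) \<le> e * norm (y - x)"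
      proof (intro exI conjI ballI impI)
        show "min d (b - x) > 0" using d x by auto
        fix y assume y: "y \<in> {x..}" "norm (y - x) < min d (b - x)"
        show "norm (f y - f x - (y - x) *\<^sub>R g x) \<le> e * norm (y - x)"
        proof (cases "y = x")
          case False
          define h where "h = y - x"
          have h: "0 < h" "h < d" "y = x + h" "y < b" using y False by (auto simp: h_def)
          have "(g has_integral f y - f x) {x..y}"
            using x h ab by (intro has_weak_derivative_on_has_integral[OF w f]) auto
          then have "(G has_integral f y - f x) {x..y}"
            by (rule has_integral_eq[rotated]) (use x h in \<open>auto simp: G_def\<close>)
          then have "norm ((f y - f x) /\<^sub>R h - g x) < e"
            using d(2)[OF h(1,2)] x h by (auto simp: G_def integral_unique)
          moreover have "f y - f x - h *\<^sub>R g x = h *\<^sub>R ((f y - f x) /\<^sub>R h - g x)"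
            using h by (simp add: scaleR_diff_right)
          ultimately have "norm (f y - f x - h *\<^sub>R g x) \<le> h * e"
            using h by (simp add: less_imp_le mult_left_mono)
          then show ?thesis using h(1) unfolding h_def by (simp add: mult.commute)
        qed simp
      qed
    qed
    then show ?thesis using N(1) by (intro exI[of _ N]) simp
  next
    case False
    then show ?thesis by (intro exI[of _ "{}"]) simp
  qed
  \<comment> \<open>Countably many subintervals exhaust (p, q), so the union of their exceptional
    sets stays negligible.\<close>
  have "\<forall>n::nat. \<exists>N. negligible N \<and> (\<forall>x. x \<in> {p + 1 / Suc n..<q - 1 / Suc n} - N \<longrightarrow>
      (f has_vector_derivative g x) (at x within {x..}))"
    by (intro allI loc) simp_all
  from choice[OF this] obtain N where "\<forall>n::nat. negligible (N n) \<and>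
    (\<forall>x. x \<in> {p + 1 / Suc n..<q - 1 / Suc n} - N n \<longrightarrow> (f has_vector_derivative g x) (at x within {x..}))" ..
  then have N: "\<And>n::nat. negligible (N n)"
    "\<And>n x. x \<in> {p + 1 / Suc n..<q - 1 / Suc n} - N n \<Longrightarrow> (f has_vector_derivative g x) (at x within {x..})"
    by simp_all
  have "{x\<in>{p<..<q}. \<not> (f has_vector_derivative g x) (at x within {x..})} \<subseteq> (\<Union>n. N n)"
  proof safe
    fix x assume x: "x \<in> {p<..<q}" "\<not> (f has_vector_derivative g x) (at x within {x..})"
    obtain n where n: "1 / Suc n < min (x - p) (q - x)"
      using nat_approx_posE[of "min (x - p) (q - x)"] x(1) by auto
    then have "x \<in> {p + 1 / Suc n..<q - 1 / Suc n}" by auto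
    then show "x \<in> (\<Union>n. N n)" using N(2)[of x n] x(2) by blast
  qed
  moreover have "negligible (\<Union>n. N n)" using N(1) by (intro negligible_countable_Union) (simp_all, auto)
  ultimately have "negligible {x\<in>{p<..<q}. \<not> (f has_vector_derivative g x) (at x within {x..})}"
    using negligible_subset by metis
  then show ?thesis by (simp add: AE_lebesgue_on_iff)
qed

text \<open>Changing the weak derivative on a null set does not change its integrals, so f is a
  primitive of h and the fundamental theorem of calculus gives a classical, two-sided derivative at
  every point.\<close>

lemma has_weak_derivative_on_AE_continuous:
  fixes f :: "real \<Rightarrow> 'a::euclidean_space"
  assumes w: "has_weak_derivative_on f g {p<..<q}" and f: "continuous_on {p<..<q} f"
    and h: "continuous_on {p<..<q} h" and ae: "AE x in lebesgue_on {p<..<q}. g x = h x"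
    and x: "x \<in> {p<..<q}"
  shows "(f has_vector_derivative h x) (at x)"
proof -
  define a where "a = (p + x) / 2"
  define b where "b = (x + q) / 2"
  have ab: "p < a" "a < x" "x < b" "b < q" using x by (auto simp: a_def b_def)
  have hc: "continuous_on {a..b} h" using h by (rule continuous_on_subset) (use ab in auto)
  have neg: "negligible {x\<in>{p<..<q}. g x \<noteq> h x}" using ae by (simp add: AE_lebesgue_on_iff)
  have "integral {a..u} h = f u - f a" if u: "u \<in> {a..b}" for u
  proof (rule integral_unique, rule has_integral_spike[OF neg])
    show "(g has_integral f u - f a) {a..u}"
      using u ab by (intro has_weak_derivative_on_has_integral[OF w f]) auto
  qed (use u ab in auto)
  then have "((\<lambda>u. f a + integral {a..u} h) has_vector_derivative h x) (at x within {a..b}) \<longleftrightarrow>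
      (f has_vector_derivative h x) (at x within {a..b})"
    using ab by (intro has_vector_derivative_cong_ev) (auto intro!: always_eventually)
  moreover have "((\<lambda>u. f a + integral {a..u} h) has_vector_derivative h x) (at x within {a..b})"
    using integral_has_vector_derivative[OF hc, of x] ab
    by (auto intro!: derivative_eq_intros)
  ultimately show ?thesis using ab at_within_Icc_at[of a x b] by simp
qed

section \<open>Calculus rules for weak derivatives\<close>

lemma has_weak_derivative_on_bounded_linear:
  fixes f :: "real \<Rightarrow> 'a::euclidean_space" and T :: "'a \<Rightarrow> 'b::euclidean_space"
  assumes I: "I \<in> sets lebesgue" and w: "has_weak_derivative_on f g I" and T: "bounded_linear T"
  shows "has_weak_derivative_on (\<lambda>x. T (f x)) (\<lambda>x. T (g x)) I"
  unfolding has_weak_derivative_on_def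
proof (intro conjI allI impI)
  have loc: "locally_integrable_on I f" "locally_integrable_on I g"
    using w by (auto simp: has_weak_derivative_on_def)
  then show "locally_integrable_on I (\<lambda>x. T (f x))" "locally_integrable_on I (\<lambda>x. T (g x))"
    using integrable_bounded_linear[OF T] by (auto simp: locally_integrable_on_def)
  fix \<phi> assume \<phi>: "C1_test_function I \<phi>"
  obtain K where K: "compact K" "K \<subseteq> I" "\<And>x. x \<notin> K \<Longrightarrow> \<phi> x = 0" "\<And>x. x \<notin> K \<Longrightarrow> deriv \<phi> x = 0"
    "\<And>x. (\<phi> has_real_derivative deriv \<phi> x) (at x)" "continuous_on UNIV (deriv \<phi>)"
    "continuous_on UNIV \<phi>"
    by (rule C1_test_functionD[OF \<phi>]; rule that; assumption)
  have "(LINT x|lebesgue_on I. deriv \<phi> x *\<^sub>R T (f x)) = T (LINT x|lebesgue_on I. deriv \<phi> x *\<^sub>R f x)"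
    unfolding linear_scale[OF bounded_linear.linear[OF T], symmetric]
    by (intro integral_bounded_linear T test_function_integrable[OF I loc(1) K(1,2,4,6)])
  also have "\<dots> = T (- (LINT x|lebesgue_on I. \<phi> x *\<^sub>R g x))"
    using w \<phi> by (simp add: has_weak_derivative_on_def)
  also have "\<dots> = - T (LINT x|lebesgue_on I. \<phi> x *\<^sub>R g x)"
    by (rule linear_neg[OF bounded_linear.linear[OF T]])
  also have "T (LINT x|lebesgue_on I. \<phi> x *\<^sub>R g x) = (LINT x|lebesgue_on I. \<phi> x *\<^sub>R T (g x))"
    unfolding linear_scale[OF bounded_linear.linear[OF T], symmetric]
    by (intro integral_bounded_linear[symmetric] T test_function_integrable[OF I loc(2) K(1,2,3,7)])
  finally show "(LINT x|lebesgue_on I. deriv \<phi> x *\<^sub>R T (f x)) = - (LINT x|lebesgue_on I. \<phi> x *\<^sub>R T (g x))" .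
qed

text \<open>Each component of m is a continuous scalar weight, so
  \<open>integrable_continuous_scaleR\<close> applies componentwise on compact sets.\<close>

lemma locally_integrable_inner_continuous:
  fixes f m :: "real \<Rightarrow> 'a::euclidean_space"
  assumes m: "continuous_on I m" and f: "locally_integrable_on I f"
  shows "locally_integrable_on I (\<lambda>x. m x \<bullet> f x)"
  unfolding locally_integrable_on_def
proof (intro allI impI, elim conjE)
  fix K assume K: "compact K" "K \<subseteq> I"
  have mK: "continuous_on K m" using m K continuous_on_subset by blast
  have fK: "integrable (lebesgue_on K) f" using f K by (auto simp: locally_integrable_on_def)
  have "integrable (lebesgue_on K) (\<lambda>x. \<Sum>b\<in>Basis. ((m x \<bullet> b) *\<^sub>R f x) \<bullet> b)"
    by (intro Bochner_Integration.integrable_sum integrable_inner_left integrable_continuous_scaleR fK K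
        continuous_intros mK)
  then show "integrable (lebesgue_on K) (\<lambda>x. m x \<bullet> f x)"
    by (subst euclidean_inner) (simp add: inner_commute)
qed

text \<open>The factor c is controlled only on I. The open sets I and \<open>- K\<close> cover the
  line, and on \<open>- K\<close> the product is identically 0, so it is C1 everywhere.\<close>

lemma C1_test_function_mult:
  assumes I: "open I" and \<phi>: "C1_test_function I \<phi>"
    and c: "\<And>x. x \<in> I \<Longrightarrow> (c has_real_derivative c' x) (at x)" "continuous_on I c'"
  shows "C1_test_function I (\<lambda>x. \<phi> x * c x)"
    and "x \<in> I \<Longrightarrow> deriv (\<lambda>x. \<phi> x * c x) x = deriv \<phi> x * c x + \<phi> x * c' x"
proof -
  obtain K where K: "compact K" "K \<subseteq> I" "\<And>x. x \<notin> K \<Longrightarrow> \<phi> x = 0" "\<And>x. x \<notin> K \<Longrightarrow> deriv \<phi> x = 0"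
    "\<And>x. (\<phi> has_real_derivative deriv \<phi> x) (at x)" "continuous_on UNIV (deriv \<phi>)"
    "continuous_on UNIV \<phi>"
    by (rule C1_test_functionD[OF \<phi>]; rule that; assumption)
  define D where "D x = (if x \<in> K then deriv \<phi> x * c x + \<phi> x * c' x else 0)" for x
  have Deq: "D x = deriv \<phi> x * c x + \<phi> x * c' x" for x
    using K(3,4) by (auto simp: D_def)
  have inI: "((\<lambda>x. \<phi> x * c x) has_real_derivative D x) (at x)" if "x \<in> I" for x
    using DERIV_mult[OF K(5) c(1)[OF that]] by (simp add: Deq algebra_simps)
  have outK: "((\<lambda>x. \<phi> x * c x) has_real_derivative D x) (at x)" if "x \<notin> K" for x
  proof -
    have "\<forall>\<^sub>F y in nhds x. \<phi> y * c y = 0"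
      using that K compact_imp_closed[OF K(1)]
      by (auto simp: eventually_nhds intro!: exI[of _ "-K"])
    then have "((\<lambda>x. \<phi> x * c x) has_real_derivative 0) (at x)"
      by (subst DERIV_cong_ev[OF refl _ refl, of _ "\<lambda>_. 0"]) auto
    then show ?thesis using that by (simp add: D_def)
  qed
  have d: "((\<lambda>x. \<phi> x * c x) has_real_derivative D x) (at x)" for x
    using inI outK K(2) by blast
  have ccont: "continuous_on I c" using c(1) DERIV_isCont continuous_at_imp_continuous_on by blast
  have "continuous_on (I \<union> - K) D"
  proof (rule continuous_on_open_Un[OF I])
    show "open (- K)" using compact_imp_closed[OF K(1)] by auto
    show "continuous_on I D" unfolding Deq[abs_def]
      using K(6,7) by (intro continuous_intros ccont c(2)) (auto intro: continuous_on_subset)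
    show "continuous_on (- K) D"
      by (rule continuous_on_eq[of _ "\<lambda>_. 0"]) (auto simp: D_def)
  qed
  moreover have "I \<union> - K = UNIV" using K(2) by auto
  ultimately have "continuous_on UNIV D" by simp
  then show "C1_test_function I (\<lambda>x. \<phi> x * c x)"
    unfolding C1_test_function_def C1_differentiable_on_def
    using d K(1-3) by (auto simp: has_real_derivative_iff_has_vector_derivative)
  show "deriv (\<lambda>x. \<phi> x * c x) x = deriv \<phi> x * c x + \<phi> x * c' x"
    using DERIV_imp_deriv[OF d] by (simp add: Deq)
qed

text \<open>The components of m are absorbed into the test function: each \<phi> (m \<bullet> b) is
  again a C1 test function, and the classical product rule for it yields the extra term m' \<bullet>
  f.\<close>

lemma has_weak_derivative_on_inner_C1:
  fixes f m :: "real \<Rightarrow> 'a::euclidean_space"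
  assumes I: "open I" and w: "has_weak_derivative_on f g I"
    and m: "\<And>x. x \<in> I \<Longrightarrow> (m has_vector_derivative m' x) (at x)" and m': "continuous_on I m'"
  shows "has_weak_derivative_on (\<lambda>x. m x \<bullet> f x) (\<lambda>x. m' x \<bullet> f x + m x \<bullet> g x) I"
proof -
  have Is: "I \<in> sets lebesgue" using I by (simp add: borel_open sets_completionI_sets)
  have loc: "locally_integrable_on I f" "locally_integrable_on I g"
    using w by (auto simp: has_weak_derivative_on_def)
  have mc: "continuous_on I m"
    using m has_vector_derivative_continuous continuous_at_imp_continuous_on by blast
  note inner_loc = locally_integrable_inner_continuous[OF mc loc(1)]
    locally_integrable_inner_continuous[OF mc loc(2)] locally_integrable_inner_continuous[OF m' loc(1)]
  show ?thesis
    unfolding has_weak_derivative_on_def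
  proof (intro conjI allI impI)
    show "locally_integrable_on I (\<lambda>x. m x \<bullet> f x)" by (rule inner_loc)
    show "locally_integrable_on I (\<lambda>x. m' x \<bullet> f x + m x \<bullet> g x)"
      using inner_loc by (auto simp: locally_integrable_on_def)
    fix \<phi> assume \<phi>: "C1_test_function I \<phi>"
    obtain K where K: "compact K" "K \<subseteq> I" "\<And>x. x \<notin> K \<Longrightarrow> \<phi> x = 0" "\<And>x. x \<notin> K \<Longrightarrow> deriv \<phi> x = 0"
      "\<And>x. (\<phi> has_real_derivative deriv \<phi> x) (at x)" "continuous_on UNIV (deriv \<phi>)"
      "continuous_on UNIV \<phi>"
      by (rule C1_test_functionD[OF \<phi>]; rule that; assumption)
    have b: "((\<lambda>x. m x \<bullet> b) has_real_derivative m' x \<bullet> b) (at x)" if "x \<in> I" for x b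
      using bounded_linear.has_vector_derivative[OF bounded_linear_inner_left m[OF that]]
      by (simp add: has_real_derivative_iff_has_vector_derivative)
    have bc: "continuous_on I (\<lambda>x. m' x \<bullet> b)" for b by (intro continuous_intros m')
    define \<psi> where "\<psi> b x = \<phi> x * (m x \<bullet> b)" for b x
    have \<psi>: "C1_test_function I (\<psi> b)" for b
      unfolding \<psi>_def[abs_def] by (rule C1_test_function_mult[OF I \<phi> b bc])
    have d\<psi>: "deriv (\<psi> b) x = deriv \<phi> x * (m x \<bullet> b) + \<phi> x * (m' x \<bullet> b)" if "x \<in> I" for b x
      unfolding \<psi>_def[abs_def] by (rule C1_test_function_mult(2)[OF I \<phi> b bc that])
    have int\<psi>: "integrable (lebesgue_on I) (\<lambda>x. \<psi> b x *\<^sub>R g x)"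
      "integrable (lebesgue_on I) (\<lambda>x. deriv (\<psi> b) x *\<^sub>R f x)" for b
      by (rule C1_test_functionD[OF \<psi>]; rule test_function_integrable[OF Is loc(2)]; assumption)
        (rule C1_test_functionD[OF \<psi>]; rule test_function_integrable[OF Is loc(1)]; assumption)
    have swap: "(LINT x|lebesgue_on I. (\<Sum>b\<in>Basis. h b x \<bullet> b)) = (\<Sum>b\<in>Basis. (LINT x|lebesgue_on I. h b x) \<bullet> b)"
      if "\<And>b. integrable (lebesgue_on I) (h b)" for h :: "'a \<Rightarrow> real \<Rightarrow> 'a"
    proof -
      have "(LINT x|lebesgue_on I. (\<Sum>b\<in>Basis. h b x \<bullet> b)) = (\<Sum>b\<in>Basis. LINT x|lebesgue_on I. h b x \<bullet> b)"
        by (rule Bochner_Integration.integral_sum) (intro integrable_inner_left that)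
      also have "\<dots> = (\<Sum>b\<in>Basis. (LINT x|lebesgue_on I. h b x) \<bullet> b)"
        by (intro sum.cong refl integral_inner_left that)
      finally show ?thesis .
    qed
    \<comment> \<open>The defining identity of the weak derivative is used once for each basis
      vector b, with test function \<open>\<psi> b\<close>, and the components are summed.\<close>
    have "(LINT x|lebesgue_on I. (\<Sum>b\<in>Basis. (deriv (\<psi> b) x *\<^sub>R f x) \<bullet> b))
        = (\<Sum>b\<in>Basis. (LINT x|lebesgue_on I. deriv (\<psi> b) x *\<^sub>R f x) \<bullet> b)"
      by (rule swap[OF int\<psi>(2)])
    also have "\<dots> = (\<Sum>b\<in>Basis. (- (LINT x|lebesgue_on I. \<psi> b x *\<^sub>R g x)) \<bullet> b)"
      using w \<psi> unfolding has_weak_derivative_on_def by (intro sum.cong) auto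
    also have "\<dots> = - (\<Sum>b\<in>Basis. (LINT x|lebesgue_on I. \<psi> b x *\<^sub>R g x) \<bullet> b)"
      by (simp add: sum_negf)
    also have "(\<Sum>b\<in>Basis. (LINT x|lebesgue_on I. \<psi> b x *\<^sub>R g x) \<bullet> b)
        = (LINT x|lebesgue_on I. (\<Sum>b\<in>Basis. (\<psi> b x *\<^sub>R g x) \<bullet> b))"
      by (rule swap[OF int\<psi>(1), symmetric])
    also have "(\<lambda>x. \<Sum>b\<in>Basis. (\<psi> b x *\<^sub>R g x) \<bullet> b) = (\<lambda>x. \<phi> x *\<^sub>R (m x \<bullet> g x))"
      by (simp add: \<psi>_def euclidean_inner[of "m _" "g _"] sum_distrib_left mult.assoc)
    also have "(LINT x|lebesgue_on I. (\<Sum>b\<in>Basis. (deriv (\<psi> b) x *\<^sub>R f x) \<bullet> b))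
        = (LINT x|lebesgue_on I. deriv \<phi> x *\<^sub>R (m x \<bullet> f x) + \<phi> x *\<^sub>R (m' x \<bullet> f x))"
    proof (rule Bochner_Integration.integral_cong)
      fix x assume "x \<in> space (lebesgue_on I)"
      then show "(\<Sum>b\<in>Basis. (deriv (\<psi> b) x *\<^sub>R f x) \<bullet> b)
          = deriv \<phi> x *\<^sub>R (m x \<bullet> f x) + \<phi> x *\<^sub>R (m' x \<bullet> f x)"
        by (simp add: d\<psi> euclidean_inner[of "m x" "f x"] euclidean_inner[of "m' x" "f x"]
            sum_distrib_left sum.distrib[symmetric] algebra_simps)
    qed simp
    also have "\<dots> = (LINT x|lebesgue_on I. deriv \<phi> x *\<^sub>R (m x \<bullet> f x)) + (LINT x|lebesgue_on I. \<phi> x *\<^sub>R (m' x \<bullet> f x))"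
      by (intro Bochner_Integration.integral_add test_function_integrable[OF Is _ K(1,2)] inner_loc K)
    finally have "(LINT x|lebesgue_on I. deriv \<phi> x *\<^sub>R (m x \<bullet> f x))
      = - ((LINT x|lebesgue_on I. \<phi> x *\<^sub>R (m' x \<bullet> f x)) + (LINT x|lebesgue_on I. \<phi> x *\<^sub>R (m x \<bullet> g x)))"
      by simp
    also have "(LINT x|lebesgue_on I. \<phi> x *\<^sub>R (m' x \<bullet> f x)) + (LINT x|lebesgue_on I. \<phi> x *\<^sub>R (m x \<bullet> g x))
      = (LINT x|lebesgue_on I. \<phi> x *\<^sub>R (m' x \<bullet> f x) + \<phi> x *\<^sub>R (m x \<bullet> g x))"
      by (intro Bochner_Integration.integral_add[symmetric] test_function_integrable[OF Is _ K(1,2)] inner_loc K)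
    finally show "(LINT x|lebesgue_on I. deriv \<phi> x *\<^sub>R (m x \<bullet> f x))
      = - (LINT x|lebesgue_on I. \<phi> x *\<^sub>R (m' x \<bullet> f x + m x \<bullet> g x))"
      by (simp add: distrib_left)
  qed
qed

section \<open>Passing between pointwise and almost-everywhere statements\<close>

lemma right_derivative_inner_constant:
  fixes u v :: "real \<Rightarrow> 'a::real_inner"
  assumes u: "(u has_vector_derivative u') (at x within {x..})"
    and v: "(v has_vector_derivative v') (at x within {x..})"
    and S: "open S" "x \<in> S" and const: "\<And>s. s \<in> S \<Longrightarrow> u s \<bullet> v s = c"
  shows "u' \<bullet> v x + u x \<bullet> v' = 0"
proof -
  have "((\<lambda>s. u s \<bullet> v s) has_vector_derivative u' \<bullet> v x + u x \<bullet> v') (at x within {x..})"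
    unfolding has_vector_derivative_def
    by (rule has_derivative_eq_rhs[OF has_derivative_inner[OF u[unfolded has_vector_derivative_def]
            v[unfolded has_vector_derivative_def]]]) (simp add: algebra_simps)
  moreover have "((\<lambda>s. u s \<bullet> v s) has_vector_derivative 0) (at x within {x..})"
  proof (subst has_vector_derivative_cong_ev)
    show "\<forall>\<^sub>F s in nhds x. s \<in> {x..} \<longrightarrow> u s \<bullet> v s = (\<lambda>_. c) s"
      using eventually_nhds_in_open[OF S] by eventually_elim (simp add: const)
  qed (use const S in auto)
  \<comment> \<open>Since x is a limit point of its right half-line, one-sided derivatives are
    unique.\<close>
  moreover have "at x within {x..} \<noteq> bot"
    by (metis at_within_Ici_at_right trivial_limit_at_right_real)
  ultimately show ?thesis using vector_derivative_unique_within by blast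
qed

text \<open>By continuity the set where f is nonzero is open, and a negligible open set is
  empty.\<close>

lemma AE_zero_imp_zero:
  fixes f :: "real \<Rightarrow> 'a::euclidean_space"
  assumes S: "open S" and f: "continuous_on S f" and ae: "AE x in lebesgue_on S. f x = 0" and x: "x \<in> S"
  shows "f x = 0"
proof (rule ccontr)
  assume nz: "f x \<noteq> 0"
  have "open (S \<inter> f -` (- {0}))"
    using f S by (intro continuous_open_preimage) auto
  moreover have "S \<inter> f -` (- {0}) = {x\<in>S. f x \<noteq> 0}" by auto
  moreover have "negligible {x\<in>S. f x \<noteq> 0}"
    using ae S by (simp add: AE_lebesgue_on_iff borel_open sets_completionI_sets)
  ultimately show False using open_not_negligible[of "{x\<in>S. f x \<noteq> 0}"] x nz by auto
qed

lemma AE_lebesgue_on_countable_cover: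
  assumes F: "countable F" "\<And>J. J \<in> F \<Longrightarrow> J \<in> sets lebesgue" and S: "S \<in> sets lebesgue"
    and rest: "negligible (S - \<Union>F)" and ae: "\<And>J. J \<in> F \<Longrightarrow> AE x in lebesgue_on J. P x"
  shows "AE x in lebesgue_on S. P x"
proof -
  have "negligible (\<Union>J\<in>F. {x\<in>J. \<not> P x})"
    using F ae by (intro negligible_countable_Union) (auto simp: AE_lebesgue_on_iff)
  then have "negligible ((\<Union>J\<in>F. {x\<in>J. \<not> P x}) \<union> (S - \<Union>F))"
    using rest by (simp add: negligible_Un)
  then have "negligible {x\<in>S. \<not> P x}"
    by (rule negligible_subset) auto
  then show ?thesis using S by (simp add: AE_lebesgue_on_iff)
qed

text \<open>The derivative is known only inside, whereas the boundary conditions live at the end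
  points; continuity carries constancy from the open interval to its closure.\<close>

lemma has_vector_derivative_zero_imp_constant_Icc:
  fixes f :: "real \<Rightarrow> 'a::real_normed_vector"
  assumes f: "continuous_on {a..b} f" and d: "\<And>x. x \<in> {a<..<b} \<Longrightarrow> (f has_vector_derivative 0) (at x)"
    and x: "x \<in> {a..b}" "y \<in> {a..b}" and ab: "a < b"
  shows "f x = f y"
proof -
  let ?m = "(a + b) / 2"
  have in_open: "f z = f ?m" if "z \<in> {a<..<b}" for z
    by (rule has_derivative_zero_unique_connected[of "{a<..<b}"])
      (use that d ab in \<open>auto simp: has_vector_derivative_def\<close>)
  have cl: "closure {a<..<b} = {a..b}" using ab by simp
  have "f z = f ?m" if "z \<in> {a..b}" for z
    by (rule continuous_constant_on_closure[of "{a<..<b}"]; (rule in_open)?; (simp only: cl f that)?)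
  then show ?thesis using x by metis
qed

subsection \<open>Directors\<close>

lemma director_eq_row: "director r i s = row i (r s)"
  by (simp add: director_def)

lemma bounded_linear_row: "bounded_linear (row i :: real^'n^'m \<Rightarrow> real^'n)"
  unfolding linear_conv_bounded_linear[symmetric]
  by (rule linearI) (auto simp: row_def vec_eq_iff)

lemma W12_onD_weak_derivative:
  assumes "W12_on I f"
  shows "has_weak_derivative_on f (weak_derivative I f) I"
  using assms unfolding W12_on_def weak_derivative_def by (metis someI_ex)

text \<open>\<open>director_deriv\<close> is a choice made separately for each row, so a witness is
  due first: the row of the weak derivative of r.\<close>

lemma has_weak_derivative_director:
  assumes "W12_on {0<..<l} r"
  shows "has_weak_derivative_on (director r i) (director_deriv l r i) {0<..<l}"
proof -
  have "has_weak_derivative_on (\<lambda>s. row i (r s)) (\<lambda>s. row i (weak_derivative {0<..<l} r s)) {0<..<l}"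
    by (rule has_weak_derivative_on_bounded_linear[OF _ W12_onD_weak_derivative[OF assms] bounded_linear_row]) simp
  then have "\<exists>g. has_weak_derivative_on (director r i) g {0<..<l}"
    unfolding director_eq_row[abs_def] by blast
  then show ?thesis unfolding director_deriv_def weak_derivative_def by (rule someI_ex)
qed

text \<open>Parseval's identity in the frame of the rows: A preserves inner products, and the
  entries of A v are the products of v with the rows.\<close>

lemma inner_rotation_matrix_rows:
  fixes A :: "real^3^3"
  assumes "rotation_matrix A"
  shows "v \<bullet> w = (v \<bullet> row 1 A) * (w \<bullet> row 1 A) + (v \<bullet> row 2 A) * (w \<bullet> row 2 A) + (v \<bullet> row 3 A) * (w \<bullet> row 3 A)"
proof -
  have "orthogonal_transformation ((*v) A)"
    using assms by (simp add: orthogonal_transformation_matrix rotation_matrix_def)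
  then have "v \<bullet> w = (A *v v) \<bullet> (A *v w)"
    by (simp add: orthogonal_transformation_def)
  then show ?thesis
    by (simp add: inner_vec_def[of "A *v v"] sum_3 matrix_vector_mul_component row_def inner_commute)
qed

lemma rotation_matrix_rows_inner:
  fixes A :: "real^'n^'n"
  assumes "rotation_matrix A"
  shows "row i A \<bullet> row j A = (if i = j then 1 else 0)"
  using assms
  by (auto simp: rotation_matrix_def orthogonal_matrix_orthonormal_rows norm_eq_1 orthogonal_def)

text \<open>In both branches the derivative is \<tau> times a positive factor.\<close>

lemma dQbar_d\<tau>_eq_0_iff: "dQbar_d\<tau> \<mu> \<tau> = 0 \<longleftrightarrow> \<tau> = 0"
  by (auto simp: dQbar_d\<tau>_eq sum_power2_eq_zero_iff)

lemma bounded_linear_cross3: "bounded_linear (cross3 v)"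
  using bilinear_cross by (simp add: bilinear_def linear_conv_bounded_linear)

section \<open>The contradiction from a planar curve\<close>

theorem theorem6p3:
  fixes l :: real
    and y :: "real \<Rightarrow> real^3"
    and r :: "real \<Rightarrow> real^3^3"
  assumes "l > 0"
    and "regular_solution l 0 (matrix_of_columns (axis 1 1) (- axis 2 1) (- axis 3 1)) y r"
  shows "\<not> (\<exists>k :: real^3. norm k = 1 \<and> (\<forall>s\<in>{0<..<l}. director r 1 s \<bullet> k = 0))"
proof
  assume "\<exists>k :: real^3. norm k = 1 \<and> (\<forall>s\<in>{0<..<l}. director r 1 s \<bullet> k = 0)"
  then obtain k :: "real^3" where k: "norm k = 1" "\<And>s. s \<in> {0<..<l} \<Longrightarrow> director r 1 s \<bullet> k = 0"
    by blast
  let ?I = "{0<..<l}"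
  let ?rbar = "matrix_of_columns (axis 1 1) (- axis 2 1) (- axis 3 1)"
  define D where "D = director r"
  define g where "g = director_deriv l r"
  define \<mu> where "\<mu> = curvature l r"
  define \<tau> where "\<tau> = torsion l r"
  have "\<exists>F. (\<forall>J\<in>F. \<exists>a b. 0 \<le> a \<and> a < b \<and> b \<le> l \<and> J = {a<..<b}) \<and> pairwise disjnt F
      \<and> ?I - \<Union>F \<in> null_sets lebesgue
      \<and> (\<forall>J\<in>F. (AE s in lebesgue_on J. \<mu> s > 0) \<or> (AE s in lebesgue_on J. \<mu> s < 0)
        \<or> (AE s in lebesgue_on J. \<mu> s = 0))"
    using assms(2) unfolding regular_solution_def \<mu>_def by (rule conjunct2)
  then obtain F where F: "\<forall>J\<in>F. \<exists>a b. 0 \<le> a \<and> a < b \<and> b \<le> l \<and> J = {a<..<b}"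
      "pairwise disjnt F" "?I - \<Union>F \<in> null_sets lebesgue"
      "\<forall>J\<in>F. (AE s in lebesgue_on J. \<mu> s > 0) \<or> (AE s in lebesgue_on J. \<mu> s < 0)
        \<or> (AE s in lebesgue_on J. \<mu> s = 0)"
    by (elim exE conjE)
  have sol: "equilibrium_solution l 0 ?rbar y r"
    using assms(2) by (simp add: regular_solution_def)
  then have yc: "continuous_on {0..l} y" and yW: "W22_on ?I y"
    and rc: "continuous_on {0..l} r" and rW: "W12_on ?I r"
    and rot: "\<And>s. s \<in> {0..l} \<Longrightarrow> rotation_matrix (r s)"
    and y': "AE s in lebesgue_on ?I. weak_derivative ?I y s = D 1 s"
    and D12: "AE s in lebesgue_on ?I. g 1 s \<bullet> D 2 s = 0"
    and bc: "y 0 = 0" "y l = 0" "r 0 = mat 1" "r l = ?rbar"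
    by (simp_all add: equilibrium_solution_def D_def g_def)
  obtain lam1 lam2 :: "real^3" where "AE s in lebesgue_on ?I. dQbar_d\<tau> (\<mu> s) (\<tau> s) = (lam2 + cross3 lam1 (y s)) \<bullet> D 1 s"
    using sol unfolding equilibrium_solution_def \<mu>_def \<tau>_def D_def by (elim conjE exE)
  define M where "M s = lam2 + cross3 lam1 (y s)" for s
  define t where "t s = M s \<bullet> D 1 s" for s
  have eq: "AE s in lebesgue_on ?I. dQbar_d\<tau> (\<mu> s) (\<tau> s) = t s"
    unfolding t_def M_def by fact
  have sub: "?I \<subseteq> {0..l}" by auto
  have Dc: "continuous_on {0..l} (D i)" for i
    unfolding D_def director_eq_row[abs_def]
    by (rule bounded_linear.continuous_on[OF bounded_linear_row rc])
  have DcI: "continuous_on ?I (D i)" for i using Dc sub continuous_on_subset by blast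
  have Dw: "has_weak_derivative_on (D i) (g i) ?I" for i
    unfolding D_def g_def by (rule has_weak_derivative_director[OF rW])
  have frame: "v \<bullet> w = (v \<bullet> D 1 s) * (w \<bullet> D 1 s) + (v \<bullet> D 2 s) * (w \<bullet> D 2 s) + (v \<bullet> D 3 s) * (w \<bullet> D 3 s)"
    if "s \<in> ?I" for v w s
    unfolding D_def director_eq_row by (rule inner_rotation_matrix_rows[OF rot]) (use that in simp)
  have orth: "D i s \<bullet> D j s = (if i = j then 1 else 0)" if "s \<in> ?I" for i j s
    unfolding D_def director_eq_row by (rule rotation_matrix_rows_inner[OF rot]) (use that in simp)
  \<comment> \<open>The weak derivative of y agrees almost everywhere with the continuous
    \<open>D 1\<close>, so y is classically C1; hence so is M, as the product rule for t
    requires.\<close>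
  have yd: "(y has_vector_derivative D 1 s) (at s)" if "s \<in> ?I" for s
  proof (rule has_weak_derivative_on_AE_continuous[OF _ _ DcI y' that])
    show "has_weak_derivative_on y (weak_derivative ?I y) ?I"
      using yW by (auto simp: W22_on_def W12_onD_weak_derivative)
    show "continuous_on ?I y" using yc sub continuous_on_subset by blast
  qed
  have Md: "(M has_vector_derivative cross3 lam1 (D 1 s)) (at s)" if "s \<in> ?I" for s
    unfolding M_def[abs_def]
    using has_vector_derivative_add[OF has_vector_derivative_const
        bounded_linear.has_vector_derivative[OF bounded_linear_cross3 yd[OF that]]] by simp
  have Mc: "continuous_on {0..l} M"
    unfolding M_def[abs_def] by (intro continuous_intros continuous_on_cross yc)
  have tc: "continuous_on {0..l} t"
    unfolding t_def[abs_def] by (intro continuous_intros Mc Dc)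
  have tcI: "continuous_on ?I t" using tc sub continuous_on_subset by blast

  \<comment> \<open>Points where all the almost-everywhere facts hold at once and all directors have
    right derivatives.\<close>
  define reg where "reg s \<longleftrightarrow> s \<in> ?I \<and> (\<forall>i. (D i has_vector_derivative g i s) (at s within {s..}))
    \<and> g 1 s \<bullet> D 2 s = 0 \<and> dQbar_d\<tau> (\<mu> s) (\<tau> s) = t s" for s
  have reg: "AE s in lebesgue_on ?I. reg s"
  proof -
    have "AE s in lebesgue_on ?I. (D i has_vector_derivative g i s) (at s within {s..})" for i
      by (rule has_weak_derivative_on_AE_right_derivative[OF Dw DcI])
    then have "AE s in lebesgue_on ?I. \<forall>i\<in>UNIV. (D i has_vector_derivative g i s) (at s within {s..})"
      by (intro AE_finite_allI) auto
    moreover have "AE s in lebesgue_on ?I. s \<in> ?I" by (rule AE_I2) simp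
    ultimately show ?thesis using D12 eq by eventually_elim (simp add: reg_def)
  qed
  have \<mu>_eq: "\<mu> s = g 1 s \<bullet> D 3 s" and \<tau>_eq: "\<tau> s = - (g 2 s \<bullet> D 3 s)" for s
    by (simp_all add: \<mu>_def \<tau>_def curvature_def torsion_def g_def D_def)
  \<comment> \<open>Differentiation of the orthonormality relations.\<close>
  have skew: "g i s \<bullet> D j s + D i s \<bullet> g j s = 0" if "reg s" for i j s
    by (rule right_derivative_inner_constant[of _ _ _ _ _ ?I "if i = j then 1 else 0"])
      (use that in \<open>auto simp: reg_def orth\<close>)
  have g_self: "g i s \<bullet> D i s = 0" if "reg s" for i s
    using skew[OF that, of i i] by (simp add: inner_commute)
  \<comment> \<open>The components of \<open>g 1 s\<close> in the frame are 0, 0 and \<mu>; this is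
    \<open>d\<^sub>1' = \<mu> d\<^sub>3\<close> in weak form.\<close>
  have g1: "g 1 s \<bullet> v = \<mu> s * (v \<bullet> D 3 s)" if "reg s" for s v
  proof -
    have "s \<in> ?I" "g 1 s \<bullet> D 2 s = 0" using that by (auto simp: reg_def)
    then show ?thesis using frame[of s "g 1 s" v] g_self[OF that, of 1] by (simp add: \<mu>_eq)
  qed

  have openJ: "open J" "J \<subseteq> ?I" "J \<noteq> {}" if "J \<in> F" for J
    using F(1) that by auto
  have measJ: "J \<in> sets lebesgue" if "J \<in> F" for J
    using F(1) that by auto
  have regJ: "AE s in lebesgue_on J. reg s" if J: "J \<in> F" for J
  proof -
    have "negligible {s\<in>?I. \<not> reg s}" using reg by (simp add: AE_lebesgue_on_iff)
    then have "negligible {s\<in>J. \<not> reg s}" by (rule negligible_subset) (use openJ[OF J] in auto)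
    then show ?thesis unfolding AE_lebesgue_on_iff[OF measJ[OF J]] .
  qed
  have t0: "t s = 0" if J: "J \<in> F" and nz: "AE s in lebesgue_on J. \<mu> s \<noteq> 0" and s: "s \<in> J" for J s
  proof -
    have cJ: "continuous_on J f" if "continuous_on ?I f" for f :: "real \<Rightarrow> real"
      using that openJ[OF J] continuous_on_subset by blast
    \<comment> \<open>Differentiating \<open>d\<^sub>1 \<bullet> k = 0\<close> gives
      \<open>\<mu> (d\<^sub>3 \<bullet> k) = 0\<close>. Continuity turns the almost-everywhere
      conclusion into one on all of J, so that it can be differentiated again.\<close>
    have D3k: "D 3 s \<bullet> k = 0" if s: "s \<in> J" for s
    proof (rule AE_zero_imp_zero[OF openJ(1)[OF J] _ _ s])
      show "continuous_on J (\<lambda>s. D 3 s \<bullet> k)" by (intro cJ continuous_intros DcI)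
      show "AE s in lebesgue_on J. D 3 s \<bullet> k = 0"
        using nz regJ[OF J]
      proof eventually_elim
        case (elim s)
        then have "s \<in> ?I" by (simp add: reg_def)
        have "g 1 s \<bullet> k + D 1 s \<bullet> 0 = 0"
          by (rule right_derivative_inner_constant[of _ _ _ "\<lambda>_. k" _ ?I 0])
            (use elim \<open>s \<in> ?I\<close> k(2) in \<open>auto simp: reg_def D_def\<close>)
        then show ?case using g1[of s k] elim by (simp add: inner_commute)
      qed
    qed
    have "AE s in lebesgue_on J. t s = 0"
      using regJ[OF J] AE_space
    proof eventually_elim
      case (elim s)
      then have s: "s \<in> ?I" "s \<in> J" using openJ[OF J] by auto
      \<comment> \<open>The second differentiation gives \<open>d\<^sub>3' \<bullet> k = 0\<close>.
        As k is a nonzero multiple of \<open>d\<^sub>2\<close>, also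
        \<open>d\<^sub>3' \<bullet> d\<^sub>2 = 0\<close>, and by skew-symmetry this product is
        \<tau>.\<close>
      have "g 3 s \<bullet> k + D 3 s \<bullet> 0 = 0"
        by (rule right_derivative_inner_constant[of _ _ _ "\<lambda>_. k" _ J 0])
          (use elim s openJ[OF J] D3k in \<open>auto simp: reg_def\<close>)
      moreover have "k \<bullet> D 1 s = 0" "k \<bullet> D 3 s = 0"
        using k(2)[OF s(1)] D3k[OF s(2)] by (simp_all add: D_def inner_commute)
      moreover have "k \<bullet> k = 1" using k(1) by (simp add: norm_eq_1)
      ultimately have "(g 3 s \<bullet> D 2 s) * (k \<bullet> D 2 s) = 0" "k \<bullet> D 2 s \<noteq> 0"
        using frame[OF s(1), of "g 3 s" k] frame[OF s(1), of k k] by auto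
      then have "g 3 s \<bullet> D 2 s = 0" by simp
      then have "\<tau> s = 0" using skew[OF elim(1), of 3 2] by (simp add: \<tau>_eq inner_commute)
      then show ?case using elim(1) dQbar_d\<tau>_eq_0_iff[of "\<mu> s" 0] by (simp add: reg_def)
    qed
    then show ?thesis using AE_zero_imp_zero[OF openJ(1)[OF J] cJ[OF tcI] _ s] by blast
  qed
  have dich: "(AE s in lebesgue_on J. \<mu> s \<noteq> 0) \<or> (AE s in lebesgue_on J. \<mu> s = 0)" if J: "J \<in> F" for J
  proof -
    have "AE s in lebesgue_on J. \<mu> s \<noteq> 0"
      if "(AE s in lebesgue_on J. \<mu> s > 0) \<or> (AE s in lebesgue_on J. \<mu> s < 0)"
      using that by (elim disjE; elim eventually_mono) simp_all
    then show ?thesis using F(4) J by metis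
  qed
  have Mg: "AE s in lebesgue_on J. M s \<bullet> g 1 s = 0" if J: "J \<in> F" for J
  proof (cases "AE s in lebesgue_on J. \<mu> s = 0")
    case True
    then show ?thesis using regJ[OF J]
      by eventually_elim (use g1 in \<open>auto simp: inner_commute\<close>)
  next
    case False
    then have nz: "AE s in lebesgue_on J. \<mu> s \<noteq> 0" using dich[OF J] by blast
    show ?thesis using regJ[OF J] AE_space
    proof eventually_elim
      case (elim s)
      then have s: "s \<in> ?I" "s \<in> J" using openJ[OF J] by auto
      \<comment> \<open>Here t vanishes on the open interval J, so its right derivative is 0; the
        cross product term drops out by orthogonality.\<close>
      have "cross3 lam1 (D 1 s) \<bullet> D 1 s + M s \<bullet> g 1 s = 0"
        by (rule right_derivative_inner_constant[of _ _ _ _ _ J 0])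
          (use elim s openJ[OF J] t0[OF J nz] has_vector_derivative_at_within[OF Md] in \<open>auto simp: reg_def t_def\<close>)
      then show ?case by (simp add: dot_cross_self)
    qed
  qed
  have rest: "negligible (?I - \<Union>F)" using F(3) by (simp add: negligible_iff_null_sets)
  have countF: "countable F" using F(2) openJ(1) by (metis countable_disjoint_open_subsets)
  note glue = AE_lebesgue_on_countable_cover[OF countF measJ _ rest]
  have tconst: "t s = t s'" if "s \<in> {0..l}" "s' \<in> {0..l}" for s s'
  proof (rule has_vector_derivative_zero_imp_constant_Icc[OF tc _ that assms(1)])
    fix s assume s: "s \<in> ?I"
    have "has_weak_derivative_on t (\<lambda>s. cross3 lam1 (D 1 s) \<bullet> D 1 s + M s \<bullet> g 1 s) ?I"
      unfolding t_def[abs_def]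
      by (intro has_weak_derivative_on_inner_C1 Dw Md continuous_on_cross DcI continuous_on_const) simp_all
    moreover have "AE s in lebesgue_on ?I. cross3 lam1 (D 1 s) \<bullet> D 1 s + M s \<bullet> g 1 s = 0"
      by (rule glue) (use Mg in \<open>simp_all add: dot_cross_self\<close>)
    ultimately show "(t has_vector_derivative 0) (at s)"
      by (rule has_weak_derivative_on_AE_continuous[OF _ tcI continuous_on_const _ s])
  qed
  have Dconst: "D i s = D i s'"
    if "AE s in lebesgue_on ?I. g i s = 0" "s \<in> {0..l}" "s' \<in> {0..l}" for i s s'
    by (rule has_vector_derivative_zero_imp_constant_Icc[OF Dc _ that(2,3) assms(1)])
      (rule has_weak_derivative_on_AE_continuous[OF Dw DcI continuous_on_const that(1)])
  \<comment> \<open>Otherwise \<open>d\<^sub>1\<close> is constant, hence \<open>y l\<close> equals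
    l times the unit vector \<open>D 1 0\<close>, contrary to \<open>y l = 0\<close>.\<close>
  have "\<exists>J\<in>F. AE s in lebesgue_on J. \<mu> s \<noteq> 0"
  proof (rule ccontr)
    assume no: "\<not> ?thesis"
    have "AE s in lebesgue_on J. g 1 s = 0" if J: "J \<in> F" for J
    proof -
      have "AE s in lebesgue_on J. \<mu> s = 0" using dich[OF J] no J by blast
      then show ?thesis using regJ[OF J]
      proof eventually_elim
        case (elim s)
        then show ?case using g1[of s "g 1 s"] by simp
      qed
    qed
    then have "AE s in lebesgue_on ?I. g 1 s = 0" by (rule glue[rotated -1]) simp_all
    then have D0: "D 1 s = D 1 0" if "s \<in> ?I" for s
      by (rule Dconst) (use that in simp_all)
    have "y l - l *\<^sub>R D 1 0 = y 0 - 0 *\<^sub>R D 1 0"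
    proof (rule has_vector_derivative_zero_imp_constant_Icc[of 0 l])
      show "continuous_on {0..l} (\<lambda>s. y s - s *\<^sub>R D 1 0)" by (intro continuous_intros yc)
      fix s assume s: "s \<in> ?I"
      show "((\<lambda>s. y s - s *\<^sub>R D 1 0) has_vector_derivative 0) (at s)"
        using yd[OF s] unfolding D0[OF s] by (auto intro!: derivative_eq_intros)
    qed (use assms(1) in auto)
    then have "D 1 0 = 0" using bc assms(1) by simp
    then show False using bc(3) rotation_matrix_rows_inner[OF rot, of 0 1 1] assms(1)
      by (simp add: D_def director_eq_row)
  qed
  then obtain J s0 where J: "J \<in> F" "AE s in lebesgue_on J. \<mu> s \<noteq> 0" "s0 \<in> J"
    using openJ(3) by blast
  \<comment> \<open>A single zero of t is enough, since t is constant.\<close>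
  have "t s = 0" if "s \<in> ?I" for s
    using tconst[of s s0] t0[OF J] that openJ(2)[OF J(1)] J(3) by auto
  \<comment> \<open>All three frame components of \<open>g 2 s\<close> vanish: along
    \<open>D 1\<close> by skew-symmetry and \<open>g 1 s \<bullet> D 2 s = 0\<close>, along
    \<open>D 2\<close> by normalization, along \<open>D 3\<close> because \<tau> = 0.\<close>
  have "AE s in lebesgue_on ?I. g 2 s = 0"
    using reg
  proof eventually_elim
    case (elim s)
    then have s: "s \<in> ?I" "\<tau> s = 0" "g 1 s \<bullet> D 2 s = 0"
      using \<open>\<And>s. s \<in> ?I \<Longrightarrow> t s = 0\<close> by (auto simp: reg_def dQbar_d\<tau>_eq_0_iff)
    then have "g 2 s \<bullet> D 1 s = 0" using skew[OF elim, of 2 1] by (simp add: inner_commute)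
    then show ?case using frame[OF s(1), of "g 2 s" "g 2 s"] s(2) g_self[OF elim, of 2] by (simp add: \<tau>_eq)
  qed
  then have "row 2 (mat 1 :: real^3^3) = row 2 ?rbar"
    using Dconst[of 2 0 l] bc assms(1) by (simp add: D_def director_eq_row)
  \<comment> \<open>The second entries are 1 and -1.\<close>
  then have "row 2 (mat 1 :: real^3^3) $ 2 = row 2 ?rbar $ 2" by simp
  then show False
    by (simp add: row_def mat_def matrix_of_columns_def transpose_def axis_def vector_3)
qed

end
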